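(* Let $(X,\mathcal R)$ be a $Q$-polynomial association scheme of class $d$ with respect to the ordering $E_0,E_1,\dots,E_d$ of its primitive idempotents, write $E_1=\frac1{|X|}\sum_{j=0}^d\theta_j^*A_j$, let $m=\theta_0^*=\operatorname{rank}E_1$, and let $\tilde X\subset S^{m-1}$ be the image of $X$ under the embedding into the first eigenspace by $E_1$. Let $1\le t\le 2d$ be an integer. Then the following are equivalent: (1) $\tilde X$ is a spherical $t$-design in $S^{m-1}$; (2) $a_i^*=0$ for $0\le i\le\lfloor (t-1)/2\rfloor$ and $c_j^*=\dfrac{mj}{m+2j-2}$ for $0\le j\le\lceil (t-1)/2\rceil$.
   Context: A symmetric association scheme of class $d$ is a finite set $X$ with a partition $\mathcal R=\{R_0,\dots,R_d\}$ of $X\times X$ into non-empty relations whose adjacency matrices $A_i$ satisfy $A_0=I$, $\sum_iA_i=J$, $A_i^T=A_i$, and each $A_iA_j$ is a linear combination of the $A_k$. The span of the $A_i$ (the Bose–Mesner algebra) has primitive idempotents $E_0=\frac1{|X|}J,E_1,\dots,E_d$; the Krein parameters $q_{i,j}^k$ are defined by $E_i\circ E_j=\frac1{|X|}\sum_kq_{i,j}^kE_k$ ($\circ$ the entrywise product). The scheme is $Q$-polynomial with respect to $E_0,\dots,E_d$ if $q_{i,j}^k=0$ whenever $i+j>k$... more precisely whenever one of $i,j,k$ exceeds the sum of the other two, and $q_{i,j}^k>0$ when one equals the sum of the other two (for the case used: $q_{1,i}^{j}=0$ if $|i-j|>1$ and $q_{1,i}^{i\pm1}>0$). Set $a_i^*=q_{1,i}^i$,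 $b_i^*=q_{1,i+1}^i$, $c_i^*=q_{1,i-1}^i$ (with $c_0^*=0$). The embedding sends $x\in X$ to $\sqrt{|X|/m}\,E_1e_x$, a unit vector in the $m$-dimensional column space of $E_1$ (identified with $\mathbb R^m$); images of $x,y$ with $(x,y)\in R_j$ have inner product $\theta_j^*/\theta_0^*$. A finite non-empty $Y\subset S^{m-1}$ is a spherical $t$-design if $\frac1{|Y|}\sum_{y\in Y}f(y)$ equals the average of $f$ over $S^{m-1}$ for every polynomial $f$ in $m$ variables of degree at most $t$. *)

theory Defs
  imports "HOL-Analysis.Analysis"
begin

definition all_ones :: "real^'x^'x" where
  "all_ones = (\<chi> x y. 1)"

definition adjacency :: "('x \<times> 'x) set \<Rightarrow> real^'x^'x" where
  "adjacency r = (\<chi> x y. if (x, y) \<in> r then 1 else 0)"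

definition hadamard :: "real^'x^'x \<Rightarrow> real^'x^'x \<Rightarrow> real^'x^'x" where
  "hadamard A B = (\<chi> x y. A $ x $ y * B $ x $ y)"

definition bose_mesner :: "nat \<Rightarrow> (nat \<Rightarrow> ('x::finite \<times> 'x) set) \<Rightarrow> (real^'x^'x) set" where
  "bose_mesner d R = span ((\<lambda>i. adjacency (R i)) ` {..d})"

definition symmetric_association_scheme ::
    "nat \<Rightarrow> (nat \<Rightarrow> ('x::finite \<times> 'x) set) \<Rightarrow> bool" where
  "symmetric_association_scheme d R \<longleftrightarrow>
     (\<forall>i\<le>d. R i \<noteq> {}) \<and>
     disjoint_family_on R {..d} \<and>
     (\<Union>i\<le>d. R i) = UNIV \<and>
     adjacency (R 0) = mat 1 \<and>
     (\<Sum>i\<le>d. adjacency (R i)) = all_ones \<and>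
     (\<forall>i\<le>d. transpose (adjacency (R i)) = adjacency (R i)) \<and>
     (\<forall>i\<le>d. \<forall>j\<le>d. adjacency (R i) ** adjacency (R j) \<in> bose_mesner d R)"

definition primitive_idempotents :: "(real^'x^'x) set \<Rightarrow> (real^'x^'x) set" where
  "primitive_idempotents \<A> =
     {e \<in> \<A>. e \<noteq> 0 \<and> e ** e = e \<and>
        (\<forall>f\<in>\<A>. \<forall>g\<in>\<A>.
           f ** f = f \<and> g ** g = g \<and> f ** g = 0 \<and> g ** f = 0 \<and> e = f + g
           \<longrightarrow> f = 0 \<or> g = 0)}"

definition idempotent_ordering ::
    "nat \<Rightarrow> (nat \<Rightarrow> ('x::finite \<times> 'x) set) \<Rightarrow> (nat \<Rightarrow> real^'x^'x) \<Rightarrow> bool" where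
  "idempotent_ordering d R E \<longleftrightarrow>
     bij_betw E {..d} (primitive_idempotents (bose_mesner d R)) \<and>
     E 0 = (1 / real CARD('x)) *\<^sub>R all_ones"

text \<open>\<open>q i j k\<close> stands for $q_{i,j}^k$; only indices up to \<open>d\<close> are constrained.\<close>

definition krein_parameters ::
    "nat \<Rightarrow> (nat \<Rightarrow> real^'x::finite^'x) \<Rightarrow> (nat \<Rightarrow> nat \<Rightarrow> nat \<Rightarrow> real) \<Rightarrow> bool" where
  "krein_parameters d E q \<longleftrightarrow>
     (\<forall>i\<le>d. \<forall>j\<le>d.
        hadamard (E i) (E j) = (1 / real CARD('x)) *\<^sub>R (\<Sum>k\<le>d. q i j k *\<^sub>R E k))"

definition Q_polynomial :: "nat \<Rightarrow> (nat \<Rightarrow> nat \<Rightarrow> nat \<Rightarrow> real) \<Rightarrow> bool" where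
  "Q_polynomial d q \<longleftrightarrow>
     (\<forall>i\<le>d. \<forall>j\<le>d. \<forall>k\<le>d.
        (i > j + k \<or> j > i + k \<or> k > i + j \<longrightarrow> q i j k = 0) \<and>
        (i = j + k \<or> j = i + k \<or> k = i + j \<longrightarrow> q i j k > 0))"

definition a_star :: "(nat \<Rightarrow> nat \<Rightarrow> nat \<Rightarrow> real) \<Rightarrow> nat \<Rightarrow> real" where
  "a_star q i = q 1 i i"

definition c_star :: "(nat \<Rightarrow> nat \<Rightarrow> nat \<Rightarrow> real) \<Rightarrow> nat \<Rightarrow> real" where
  "c_star q i = (if i = 0 then 0 else q 1 (i - 1) i)"

definition column_space :: "real^'x^'x \<Rightarrow> (real^'x::finite) set" where
  "column_space A = span (columns A)"

text \<open>
  Only the restriction of \<open>\<phi>\<close> to the subspace \<open>V\<close> matters: every linear map on \<open>V\<close> extends to a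
  linear map on the ambient space.
\<close>

definition isometric_identification ::
    "(real^'x) set \<Rightarrow> (real^'x::finite \<Rightarrow> real^'m::finite) \<Rightarrow> bool" where
  "isometric_identification V \<phi> \<longleftrightarrow>
     linear \<phi> \<and> (\<forall>u\<in>V. \<forall>v\<in>V. \<phi> u \<bullet> \<phi> v = u \<bullet> v) \<and> \<phi> ` V = UNIV"

definition embedding ::
    "real^'x^'x \<Rightarrow> (real^'x \<Rightarrow> real^'m) \<Rightarrow> 'x::finite \<Rightarrow> real^'m::finite" where
  "embedding A \<phi> x = \<phi> (sqrt (real CARD('x) / real (rank A)) *\<^sub>R (A *v axis x 1))"

definition polynomial_of_degree_le :: "nat \<Rightarrow> (real^'m::finite \<Rightarrow> real) \<Rightarrow> bool" where
  "polynomial_of_degree_le t f \<longleftrightarrow>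
     (\<exists>c :: ('m \<Rightarrow> nat) \<Rightarrow> real.
        \<forall>x. f x = (\<Sum>\<alpha> | sum \<alpha> UNIV \<le> t. c \<alpha> * (\<Prod>i\<in>UNIV. (x $ i) ^ \<alpha> i)))"

lemma finite_exponents: "finite {\<alpha> :: 'm::finite \<Rightarrow> nat. sum \<alpha> UNIV \<le> t}"
proof (rule finite_subset)
  show "{\<alpha> :: 'm \<Rightarrow> nat. sum \<alpha> UNIV \<le> t} \<subseteq> UNIV \<rightarrow>\<^sub>E {..t}"
  proof
    fix \<alpha> :: "'m \<Rightarrow> nat" assume "\<alpha> \<in> {\<alpha>. sum \<alpha> UNIV \<le> t}"
    moreover have "\<alpha> i \<le> sum \<alpha> UNIV" for i
      by (rule member_le_sum) simp_all
    ultimately have "\<alpha> i \<le> t" for i using order_trans by blast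
    then show "\<alpha> \<in> UNIV \<rightarrow>\<^sub>E {..t}" by (simp add: PiE_iff)
  qed
  show "finite ((UNIV :: 'm set) \<rightarrow>\<^sub>E {..t})"
    by (rule finite_PiE) simp_all
qed

text \<open>
  The normalised surface measure of the unit sphere is obtained by projecting the uniform
  distribution on the unit ball radially.  It is a probability measure living on the sphere and
  invariant under orthogonal transformations (the library's change of variables asks for a
  well-ordered index type there); in dimension one it gives each
  of the two points mass one half.
\<close>

definition sphere_measure :: "'a::euclidean_space measure" where
  "sphere_measure = distr (uniform_measure lborel (ball 0 1)) borel (\<lambda>x. x /\<^sub>R norm x)"

lemma sets_sphere_measure [simp]: "sets sphere_measure = sets borel"
  by (simp add: sphere_measure_def)

lemma emeasure_sphere_measure:
  assumes "(B :: 'a::euclidean_space set) \<in> sets borel"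
  shows "emeasure sphere_measure B =
    emeasure lborel (ball 0 1 \<inter> {x. x /\<^sub>R norm x \<in> B}) /
      emeasure lborel (ball (0::'a) 1)"
proof -
  have m: "(\<lambda>x::'a. x /\<^sub>R norm x) \<in> borel \<rightarrow>\<^sub>M borel" by measurable
  have s: "{x. x /\<^sub>R norm x \<in> B} \<in> sets borel"
    using measurable_sets[OF m assms] by (simp add: vimage_def)
  have "emeasure sphere_measure B = emeasure (uniform_measure lborel (ball (0::'a) 1)) {x. x /\<^sub>R norm x \<in> B}"
    unfolding sphere_measure_def using assms
    by (subst emeasure_distr) (auto simp: vimage_def)
  then show ?thesis using s by simp
qed

lemma emeasure_unit_ball_divide_self:
  "emeasure lborel (ball (0::'a::euclidean_space) 1) / emeasure lborel (ball (0::'a) 1) = 1"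
proof (rule ennreal_divide_self)
  show "emeasure lborel (ball (0::'a) 1) \<noteq> 0"
    using unit_ball_vol_pos[of "real DIM('a)"] by (simp add: emeasure_ball del: unit_ball_vol_pos)
  show "emeasure lborel (ball (0::'a) 1) < top"
    using emeasure_lborel_ball_finite[of "0::'a" 1] by simp
qed

lemma emeasure_sphere_measure_UNIV:
  "emeasure sphere_measure (UNIV :: 'a::euclidean_space set) = 1"
  by (simp add: emeasure_sphere_measure emeasure_unit_ball_divide_self)

lemma emeasure_sphere_measure_sphere:
  "emeasure sphere_measure (sphere (0 :: 'a::euclidean_space) 1) = 1"
proof -
  have eq: "ball 0 1 \<inter> {x::'a. x /\<^sub>R norm x \<in> sphere 0 1} = ball 0 1 - {0}"
    by auto
  have "emeasure lborel (ball (0::'a) 1 - {0}) = emeasure lborel (ball (0::'a) 1)"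
    by (rule emeasure_Diff_null_set) auto
  then show ?thesis
    by (simp only: emeasure_sphere_measure[OF borel_closed[OF closed_sphere]] eq
        emeasure_unit_ball_divide_self)
qed

lemma emeasure_sphere_measure_orthogonal:
  fixes T :: "real^'n::{finite,wellorder} \<Rightarrow> real^'n::_"
  assumes T: "orthogonal_transformation T" and B: "B \<in> sets borel"
  shows "emeasure sphere_measure (T -` B) = emeasure sphere_measure B"
proof -
  let ?N = "\<lambda>x::real^'n::_. x /\<^sub>R norm x"
  have lin: "linear T" using T by (rule orthogonal_transformation_linear)
  have Tm: "T \<in> borel \<rightarrow>\<^sub>M borel"
    using linear_continuous_on[of T UNIV] lin
    by (intro borel_measurable_continuous_onI) (simp add: linear_conv_bounded_linear)
  have TB: "T -` B \<in> sets borel" using measurable_sets[OF Tm B] by simp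
  have Nm: "?N \<in> borel \<rightarrow>\<^sub>M borel" by measurable
  have meas: "ball 0 1 \<inter> {x. ?N x \<in> C} \<in> sets borel" if "C \<in> sets borel" for C
    using measurable_sets[OF Nm that] by (auto simp: vimage_def)
  have lm: "ball 0 1 \<inter> {x. ?N x \<in> C} \<in> lmeasurable" if "C \<in> sets borel" for C
    by (rule bounded_set_imp_lmeasurable)
      (use meas[OF that] bounded_subset[OF bounded_ball] in auto)
  have surj: "surj T" using T by (rule orthogonal_transformation_surj)
  have norm: "norm (T x) = norm x" for x using T by (rule orthogonal_transformation_norm)
  have TN: "T (?N x) = ?N (T x)" for x by (simp add: norm linear_cmul[OF lin])
  have img: "T ` (ball 0 1 \<inter> {x. ?N x \<in> T -` B}) = ball 0 1 \<inter> {x. ?N x \<in> B}"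
  proof (intro set_eqI iffI)
    fix y assume "y \<in> ball 0 1 \<inter> {x. ?N x \<in> B}"
    moreover obtain x where "y = T x" using surj by (rule surjE)
    ultimately show "y \<in> T ` (ball 0 1 \<inter> {x. ?N x \<in> T -` B})"
      by (intro image_eqI[of _ _ x]) (simp_all add: TN norm)
  qed (auto simp: TN norm)
  have "measure lebesgue (ball 0 1 \<inter> {x. ?N x \<in> T -` B}) = measure lebesgue (ball 0 1 \<inter> {x. ?N x \<in> B})"
    using measure_orthogonal_image[OF T lm[OF TB]] by (simp only: img)
  then have "emeasure lebesgue (ball 0 1 \<inter> {x. ?N x \<in> T -` B}) = emeasure lebesgue (ball 0 1 \<inter> {x. ?N x \<in> B})"
    by (simp only: emeasure_eq_measure2[OF lm[OF TB]] emeasure_eq_measure2[OF lm[OF B]])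
  then have "emeasure lborel (ball 0 1 \<inter> {x. ?N x \<in> T -` B}) = emeasure lborel (ball 0 1 \<inter> {x. ?N x \<in> B})"
    using meas[OF TB] meas[OF B] by simp
  then show ?thesis
    by (simp only: emeasure_sphere_measure[OF TB] emeasure_sphere_measure[OF B])
qed

definition spherical_design :: "nat \<Rightarrow> (real^'m::finite) set \<Rightarrow> bool" where
  "spherical_design t Y \<longleftrightarrow>
     finite Y \<and> Y \<noteq> {} \<and> Y \<subseteq> sphere 0 1 \<and>
     (\<forall>f. polynomial_of_degree_le t f \<longrightarrow>
        (\<Sum>y\<in>Y. f y) / real (card Y) = (\<integral>x. f x \<partial>sphere_measure))"

end

theory Submission
  imports Defs
begin

text \<open>
  Comparing the moment tensors of \<open>Y\<close> and of the sphere shows that \<open>Y\<close> is a \<open>t\<close>-design iff for every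
  \<open>k \<le> t\<close> the average of \<open>(x \<bullet> y)\<^sup>k\<close> over \<open>Y \<times> Y\<close> equals the integral of \<open>u\<^sub>1\<^sup>k\<close> over the sphere.  For the
  embedded scheme these averages are generated by the tridiagonal matrix with entries \<open>c\<^sub>j\<^sup>*\<close>, \<open>a\<^sub>j\<^sup>*\<close>,
  \<open>b\<^sub>j\<^sup>*\<close>, because entrywise multiplication by \<open>E\<^sub>1\<close> is tridiagonal on the \<open>E\<^sub>j\<close>; for the sphere they
  are generated by the Gegenbauer recurrence, with \<open>c\<^sub>j = mj/(m+2j-2)\<close>, \<open>a\<^sub>j = 0\<close>.  In both cases
  \<open>a\<^sub>j + b\<^sub>j + c\<^sub>j = m\<close>, and the moments up to order \<open>t\<close> determine, and are determined by, the \<open>a\<^sub>i\<close>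
  with \<open>2i + 1 \<le> t\<close> and the \<open>c\<^sub>j\<close> with \<open>2j \<le> t\<close>.
\<close>

section \<open>Orthogonal invariance of the sphere measure\<close>

lemma orthogonal_transformation_borel_measurable:
  fixes T :: "'a::euclidean_space \<Rightarrow> 'a"
  assumes "orthogonal_transformation T"
  shows "T \<in> borel_measurable borel"
  using linear_continuous_on[of T UNIV] orthogonal_transformation_linear[OF assms]
  by (intro borel_measurable_continuous_onI) (simp add: linear_conv_bounded_linear)

lemma nn_integral_lborel_translate:
  fixes f :: "'a::euclidean_space \<Rightarrow> ennreal"
  assumes [measurable]: "f \<in> borel_measurable borel"
  shows "(\<integral>\<^sup>+x. f (a + x) \<partial>lborel) = (\<integral>\<^sup>+x. f x \<partial>lborel)"
proof -
  have "(\<integral>\<^sup>+x. f x \<partial>lborel) = (\<integral>\<^sup>+x. f x \<partial>distr lborel borel ((+) a))"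
    by (simp add: lborel_distr_plus)
  then show ?thesis by (simp add: nn_integral_distr)
qed

text \<open>
  The usual uniqueness argument for translation invariant measures, comparing \<open>T\<close>-images with a
  ball, which \<open>T\<close> preserves.  Unlike the change of variables theorem it needs no order on the index
  type.
\<close>

lemma emeasure_lborel_orthogonal_vimage:
  fixes T :: "'a::euclidean_space \<Rightarrow> 'a"
  assumes T: "orthogonal_transformation T" and A[measurable]: "A \<in> sets borel"
  shows "emeasure lborel (T -` A) = emeasure lborel A"
proof -
  define B where "B = ball (0::'a) 1"
  have [measurable]: "B \<in> sets borel" by (simp add: B_def)
  note Tm[measurable] = orthogonal_transformation_borel_measurable[OF T]
  have lin: "linear T" using T by (rule orthogonal_transformation_linear)
  have surj: "surj T" using T by (rule orthogonal_transformation_surj)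
  have TA: "T -` A \<in> sets borel" using measurable_sets[OF Tm A] by simp
  \<comment> \<open>With \<open>y = T z\<close>, a shift by \<open>y\<close> outside
    \<open>T\<close> becomes a shift by \<open>z\<close> inside it, which Lebesgue measure does not
    see.\<close>
  have shift: "(\<integral>\<^sup>+x. indicator A (T x) \<partial>lborel) = (\<integral>\<^sup>+x. indicator A (T x + y) \<partial>lborel)" for y
  proof -
    obtain z where z: "y = T z" using surj by (rule surjE)
    have "(\<integral>\<^sup>+x. indicator A (T (z + x)) \<partial>lborel) = (\<integral>\<^sup>+x. indicator A (T x) \<partial>lborel)"
      by (rule nn_integral_lborel_translate[of "\<lambda>x. indicator A (T x)"]) measurable
    then show ?thesis by (simp add: z linear_add[OF lin] add.commute)
  qed
  \<comment> \<open>As \<open>norm (y - T x) = norm (z - x)\<close>, the condition on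
    \<open>x\<close> describes a unit ball around \<open>z\<close>, whatever \<open>y\<close>
    is.\<close>
  have ball: "(\<integral>\<^sup>+x. indicator B (y - T x) \<partial>lborel) = emeasure lborel B" for y
  proof -
    obtain z where z: "y = T z" using surj by (rule surjE)
    have "norm (y - T x) = norm (z - x)" for x
      by (metis T lin linear_diff orthogonal_transformation_norm z)
    then have "(\<integral>\<^sup>+x. indicator B (y - T x) \<partial>lborel) = (\<integral>\<^sup>+x. indicator (ball z 1) x \<partial>lborel)"
      by (intro nn_integral_cong) (auto simp: B_def indicator_def dist_norm norm_minus_commute)
    then show ?thesis by (simp add: B_def emeasure_ball)
  qed
  have "emeasure lborel (T -` A) * emeasure lborel B =
      (\<integral>\<^sup>+y. (\<integral>\<^sup>+x. indicator A (T x) \<partial>lborel) * indicator B y \<partial>lborel)"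
  proof -
    have "(\<integral>\<^sup>+x. indicator A (T x) \<partial>lborel) = (\<integral>\<^sup>+x. indicator (T -` A) x \<partial>lborel)"
      by (intro nn_integral_cong) (auto simp: indicator_def)
    then show ?thesis using TA by (simp add: nn_integral_cmult_indicator)
  qed
  also have "\<dots> = (\<integral>\<^sup>+y. (\<integral>\<^sup>+x. indicator A (T x + y) * indicator B y \<partial>lborel) \<partial>lborel)"
    by (subst nn_integral_multc) (simp_all flip: shift)
  also have "\<dots> = (\<integral>\<^sup>+x. (\<integral>\<^sup>+y. indicator A (T x + y) * indicator B y \<partial>lborel) \<partial>lborel)"
    by (intro lborel_pair.Fubini') measurable
  also have "\<dots> = (\<integral>\<^sup>+x. (\<integral>\<^sup>+y. indicator A y * indicator B (y - T x) \<partial>lborel) \<partial>lborel)"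
  proof (rule nn_integral_cong)
    fix x
    show "(\<integral>\<^sup>+y. indicator A (T x + y) * indicator B y \<partial>lborel) =
        (\<integral>\<^sup>+y. indicator A y * indicator B (y - T x) \<partial>lborel)"
      using nn_integral_lborel_translate[of "\<lambda>y. indicator A y * indicator B (y - T x)" "T x"]
      by simp
  qed
  also have "\<dots> = (\<integral>\<^sup>+y. (\<integral>\<^sup>+x. indicator A y * indicator B (y - T x) \<partial>lborel) \<partial>lborel)"
    by (intro lborel_pair.Fubini') measurable
  also have "\<dots> = emeasure lborel A * emeasure lborel B"
    by (simp add: nn_integral_cmult ball nn_integral_multc)
  \<comment> \<open>The volume of the ball is positive and finite, so it cancels.\<close>
  finally show ?thesis
    using unit_ball_vol_pos[of "real DIM('a)"]
    by (subst (asm) (1 2) mult.commute, subst (asm) ennreal_mult_cancel_left)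
       (auto simp: B_def emeasure_ball simp del: unit_ball_vol_pos)
qed

text \<open>\<open>T\<close> commutes with the radial projection and preserves the unit ball, so the
  claim reduces to the invariance of Lebesgue measure.\<close>

lemma distr_sphere_measure_orthogonal:
  fixes T :: "'a::euclidean_space \<Rightarrow> 'a"
  assumes T: "orthogonal_transformation T"
  shows "distr sphere_measure borel T = sphere_measure"
proof (rule measure_eqI)
  note Tm = orthogonal_transformation_borel_measurable[OF T]
  fix B assume "B \<in> sets (distr sphere_measure borel T)"
  then have B: "B \<in> sets borel" by simp
  have TB: "T -` B \<in> sets borel" using measurable_sets[OF Tm B] by simp
  have Nm: "(\<lambda>x::'a. x /\<^sub>R norm x) \<in> borel \<rightarrow>\<^sub>M borel" by measurable
  have meas: "ball 0 1 \<inter> {x. x /\<^sub>R norm x \<in> B} \<in> sets borel"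
    using measurable_sets[OF Nm B] by (auto simp: vimage_def)
  have norm: "norm (T x) = norm x" for x using T by (rule orthogonal_transformation_norm)
  have "T (x /\<^sub>R norm x) = T x /\<^sub>R norm (T x)" for x
    by (simp add: norm linear_cmul[OF orthogonal_transformation_linear[OF T]])
  then have "ball 0 1 \<inter> {x. x /\<^sub>R norm x \<in> T -` B} = T -` (ball 0 1 \<inter> {x. x /\<^sub>R norm x \<in> B})"
    by (auto simp: norm)
  then have "emeasure sphere_measure (T -` B) = emeasure sphere_measure B"
    by (simp only: emeasure_sphere_measure[OF TB] emeasure_sphere_measure[OF B]
        emeasure_lborel_orthogonal_vimage[OF T meas])
  then show "emeasure (distr sphere_measure borel T) B = emeasure sphere_measure B"
    using Tm B by (subst emeasure_distr)
      (simp_all add: measurable_cong_sets[OF sets_sphere_measure refl] space_borel sets_eq_imp_space_eq[OF sets_sphere_measure])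
qed simp

lemma integral_sphere_measure_orthogonal:
  fixes T :: "'a::euclidean_space \<Rightarrow> 'a" and f :: "'a \<Rightarrow> real"
  assumes T: "orthogonal_transformation T" and f: "f \<in> borel_measurable borel"
  shows "(\<integral>u. f (T u) \<partial>sphere_measure) = (\<integral>u. f u \<partial>sphere_measure)"
  using integral_distr[of T sphere_measure borel f] f
    orthogonal_transformation_borel_measurable[OF T]
  by (simp add: distr_sphere_measure_orthogonal[OF T] measurable_cong_sets[OF sets_sphere_measure refl])

section \<open>Integration against the sphere measure\<close>

lemma emeasure_sphere_measure_space:
  "emeasure sphere_measure (space (sphere_measure :: 'a::euclidean_space measure)) = 1"
  by (simp add: sets_eq_imp_space_eq[OF sets_sphere_measure] emeasure_sphere_measure_UNIV)

lemma finite_measure_sphere_measure: "finite_measure (sphere_measure :: 'a::euclidean_space measure)"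
  by (rule finite_measureI) (simp add: emeasure_sphere_measure_space)

text \<open>The measure is defined on the whole space; this lets identities valid only for unit
  vectors be used under the integral.\<close>

lemma AE_sphere_measure_norm: "AE u in (sphere_measure :: 'a::euclidean_space measure). norm u = 1"
proof -
  interpret finite_measure "sphere_measure :: 'a measure" by (rule finite_measure_sphere_measure)
  have sp: "space (sphere_measure :: 'a measure) = UNIV"
    by (simp add: sets_eq_imp_space_eq[OF sets_sphere_measure])
  have "emeasure sphere_measure (UNIV - sphere (0::'a) 1) = 0"
    by (subst emeasure_Diff)
      (simp_all add: emeasure_sphere_measure_sphere emeasure_sphere_measure_UNIV)
  then show ?thesis
    by (intro AE_I[of _ _ "UNIV - sphere (0::'a) 1"]) (auto simp: sp)
qed

lemma integrable_sphere_measure: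
  fixes f :: "'a::euclidean_space \<Rightarrow> real"
  assumes f: "continuous_on UNIV f"
  shows "integrable sphere_measure f"
proof -
  interpret finite_measure "sphere_measure :: 'a measure" by (rule finite_measure_sphere_measure)
  have "compact (f ` sphere 0 1)"
    by (intro compact_continuous_image continuous_on_subset[OF f]) auto
  then obtain K where K: "\<And>u. norm u = 1 \<Longrightarrow> norm (f u) \<le> K"
    using compact_imp_bounded[of "f ` sphere 0 1"] unfolding bounded_iff by (metis image_eqI mem_sphere_0)
  show ?thesis
  proof (rule integrable_const_bound)
    show "AE u in sphere_measure. norm (f u) \<le> K"
      using AE_sphere_measure_norm by eventually_elim (rule K)
    show "f \<in> borel_measurable sphere_measure"
      using borel_measurable_continuous_onI[OF f]
      by (simp add: measurable_cong_sets[OF sets_sphere_measure refl])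
  qed
qed

section \<open>Moments of the sphere\<close>

text \<open>Some orthogonal map takes \<open>x\<close> to \<open>y\<close>, and the sphere measure
  is invariant under it.\<close>

lemma integral_inner_power_norm_cong:
  fixes x y :: "real^'m::finite"
  assumes "norm x = norm y"
  shows "(\<integral>u. (x \<bullet> u) ^ k \<partial>sphere_measure) = (\<integral>u. (y \<bullet> u) ^ k \<partial>sphere_measure)"
proof -
  obtain T where T: "orthogonal_transformation T" "T x = y"
    using orthogonal_transformation_exists[OF assms] by blast
  have "(\<integral>u. (x \<bullet> u) ^ k \<partial>sphere_measure) = (\<integral>u. (y \<bullet> T u) ^ k \<partial>sphere_measure)"
    using T by (metis orthogonal_transformation_def)
  also have "\<dots> = (\<integral>u. (y \<bullet> u) ^ k \<partial>sphere_measure)"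
    by (rule integral_sphere_measure_orthogonal[OF T(1)]) measurable
  finally show ?thesis .
qed

lemma integral_inner_power_scale:
  fixes x :: "real^'m::finite"
  shows "(\<integral>u. (x \<bullet> u) ^ k \<partial>sphere_measure) =
    norm x ^ k * (\<integral>u. (u $ a) ^ k \<partial>(sphere_measure :: (real^'m) measure))"
proof -
  have "(\<integral>u. (x \<bullet> u) ^ k \<partial>sphere_measure) =
      (\<integral>u. ((norm x *\<^sub>R axis a 1 :: real^'m) \<bullet> u) ^ k \<partial>sphere_measure)"
    by (rule integral_inner_power_norm_cong) simp
  then show ?thesis by (simp add: inner_axis' power_mult_distrib)
qed

text \<open>A vector and its negative have the same norm, so an odd moment equals its own
  negative.\<close>

lemma integral_coordinate_power_odd:
  assumes "odd k"
  shows "(\<integral>u. (u $ a) ^ k \<partial>(sphere_measure :: (real^'m::finite) measure)) = 0"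
  using assms integral_inner_power_norm_cong[of "axis a 1 :: real^'m" "- axis a 1" k]
  by (simp add: inner_axis')

text \<open>Compares coefficients of \<open>s\<^sup>2\<close> in the moments of the linear forms \<open>u\<^sub>a + s u\<^sub>j\<close>, of norm \<open>\<surd>(1 + s\<^sup>2)\<close>.\<close>

lemma integral_coordinate_power_times_square:
  fixes a j :: "'m::finite"
  assumes "j \<noteq> a" and "1 \<le> l"
  shows "(2 * real l - 1) * (\<integral>u. (u $ a) ^ (2 * l - 2) * (u $ j)\<^sup>2 \<partial>(sphere_measure :: (real^'m) measure)) =
    (\<integral>u. (u $ a) ^ (2 * l) \<partial>(sphere_measure :: (real^'m) measure))"
proof -
  let ?\<sigma> = "sphere_measure :: (real^'m) measure"
  let ?I = "\<integral>u. (u $ a) ^ (2 * l) \<partial>?\<sigma>"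
  \<comment> \<open>Two forms of the coefficient of \<open>s ^ i\<close>: \<open>c\<close> comes
    from expanding the integrand, \<open>e\<close> from expanding
    \<open>(1 + s ^ 2) ^ l * ?I\<close>.\<close>
  define c where "c i = real (2 * l choose i) * (\<integral>u. (u $ j) ^ i * (u $ a) ^ (2 * l - i) \<partial>?\<sigma>)" for i
  define e where "e i = (if even i then real (l choose (i div 2)) * ?I else 0)" for i
  have "(\<Sum>i\<le>2 * l. c i * s ^ i) = (\<Sum>i\<le>2 * l. e i * s ^ i)" for s :: real
  proof -
    let ?x = "axis a 1 + s *\<^sub>R axis j 1 :: real^'m"
    have "?x \<bullet> ?x = 1 + s\<^sup>2"
      using assms by (simp add: inner_add inner_axis_axis power2_eq_square)
    then have nx: "norm ?x ^ (2 * l) = (1 + s\<^sup>2) ^ l"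
      by (simp add: power_mult power2_norm_eq_inner)
    have "(\<Sum>i\<le>2 * l. c i * s ^ i) = (\<Sum>i\<le>2 * l. \<integral>u. real (2 * l choose i) * (s * u $ j) ^ i * (u $ a) ^ (2 * l - i) \<partial>?\<sigma>)"
      unfolding c_def by (intro sum.cong refl) (simp add: power_mult_distrib mult_ac flip: integral_mult_right_zero)
    also have "\<dots> = (\<integral>u. (\<Sum>i\<le>2 * l. real (2 * l choose i) * (s * u $ j) ^ i * (u $ a) ^ (2 * l - i)) \<partial>?\<sigma>)"
      by (intro Bochner_Integration.integral_sum[symmetric] integrable_sphere_measure continuous_intros)
    also have "\<dots> = (\<integral>u. (?x \<bullet> u) ^ (2 * l) \<partial>?\<sigma>)"
      by (simp add: binomial_ring[symmetric] inner_add_left inner_axis' add.commute)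
    also have "\<dots> = (1 + s\<^sup>2) ^ l * ?I"
      by (simp only: integral_inner_power_scale[of _ _ a] nx)
    also have "\<dots> = (\<Sum>i\<le>l. real (l choose i) * ?I * s ^ (2 * i))"
      by (subst add.commute, subst binomial_ring)
        (simp add: sum_distrib_left sum_distrib_right mult_ac flip: power_mult)
    also have "\<dots> = (\<Sum>i\<in>(*) 2 ` {..l}. e i * s ^ i)"
      by (subst sum.reindex) (auto simp: inj_on_def e_def)
    also have "\<dots> = (\<Sum>i\<le>2 * l. e i * s ^ i)"
      by (intro sum.mono_neutral_left) (auto simp: e_def elim!: evenE)
    finally show ?thesis .
  qed
  then have "c 2 = e 2" using polyfun_eq_coeffs[of c "2 * l" e] assms(2) by simp
  moreover have "real (2 * l choose 2) = real l * (2 * real l - 1)"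
    using assms(2) by (simp add: choose_two of_nat_diff)
  ultimately show ?thesis using assms(2) by (simp add: c_def e_def mult_ac)
qed

text \<open>On the sphere the squared coordinates sum to 1, so the moment of order
  \<open>2 * l - 2\<close> splits into the one of order \<open>2 * l\<close> and
  \<open>CARD('m) - 1\<close> equal mixed moments.\<close>

lemma integral_coordinate_power_step:
  fixes a :: "'m::finite"
  assumes "1 \<le> l"
  shows "(real CARD('m) + 2 * real l - 2) * (\<integral>u. (u $ a) ^ (2 * l) \<partial>(sphere_measure :: (real^'m) measure)) =
    (2 * real l - 1) * (\<integral>u. (u $ a) ^ (2 * l - 2) \<partial>(sphere_measure :: (real^'m) measure))"
proof -
  let ?\<sigma> = "sphere_measure :: (real^'m) measure"
  let ?I = "\<lambda>k. \<integral>u. (u $ a) ^ k \<partial>?\<sigma>"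
  have "?I (2 * l - 2) = (\<integral>u. (\<Sum>j\<in>UNIV. (u $ a) ^ (2 * l - 2) * (u $ j)\<^sup>2) \<partial>?\<sigma>)"
  proof (rule Bochner_Integration.integral_cong_AE)
    show "AE u in ?\<sigma>. (u $ a) ^ (2 * l - 2) = (\<Sum>j\<in>UNIV. (u $ a) ^ (2 * l - 2) * (u $ j)\<^sup>2)"
      using AE_sphere_measure_norm
    proof eventually_elim
      case (elim u)
      then have "(\<Sum>j\<in>UNIV. (u $ j)\<^sup>2) = 1"
        by (simp add: norm_eq_1 inner_vec_def power2_eq_square)
      then show ?case by (simp flip: sum_distrib_left)
    qed
  qed (intro borel_measurable_integrable integrable_sphere_measure continuous_intros)+
  also have "\<dots> = (\<Sum>j\<in>UNIV. \<integral>u. (u $ a) ^ (2 * l - 2) * (u $ j)\<^sup>2 \<partial>?\<sigma>)"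
    by (intro Bochner_Integration.integral_sum integrable_sphere_measure continuous_intros)
  also have "\<dots> = ?I (2 * l) + (\<Sum>j\<in>UNIV - {a}. \<integral>u. (u $ a) ^ (2 * l - 2) * (u $ j)\<^sup>2 \<partial>?\<sigma>)"
  proof -
    have "2 * l = 2 * l - 2 + 2" using assms by simp
    then have "(u $ a) ^ (2 * l - 2) * (u $ a)\<^sup>2 = (u $ a) ^ (2 * l)" for u :: "real^'m"
      by (metis power_add)
    then show ?thesis by (simp add: sum.remove[of UNIV a])
  qed
  finally have "(2 * real l - 1) * ?I (2 * l - 2) = (2 * real l - 1) * ?I (2 * l) + (\<Sum>j\<in>UNIV - {a}. ?I (2 * l))"
    using integral_coordinate_power_times_square[OF _ assms, of _ a]
    by (simp add: distrib_left sum_distrib_left)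
  moreover have "real (CARD('m) - 1) = real CARD('m) - 1"
    by (simp add: of_nat_diff Suc_leI)
  ultimately show ?thesis by (simp add: algebra_simps card_Diff_singleton)
qed

text \<open>
  The integral of \<open>u\<^sub>1\<^sup>k P\<^sub>j(u\<^sub>1)\<close> over \<open>S\<^sup>m\<^sup>-\<^sup>1\<close>, where \<open>P\<^sub>j\<close> is the Gegenbauer polynomial with \<open>P\<^sub>j(1) = 1\<close>.
\<close>

definition gegenbauer_moment :: "nat \<Rightarrow> nat \<Rightarrow> nat \<Rightarrow> real" where
  "gegenbauer_moment m k j =
     (if j \<le> k \<and> even (k - j)
      then fact k / (2 ^ ((k - j) div 2) * fact ((k - j) div 2) * (\<Prod>i<(k + j) div 2. real (m + 2 * i)))
      else 0)"

text \<open>Iterating the step gives \<open>(2l - 1)!! / (m (m + 2) ... (m + 2l - 2))\<close> for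
  \<open>k = 2l\<close>, which is the closed form at \<open>j = 0\<close>.\<close>

lemma integral_coordinate_power:
  "(\<integral>u. (u $ a) ^ k \<partial>(sphere_measure :: (real^'m::finite) measure)) = gegenbauer_moment CARD('m) k 0"
proof (cases "even k")
  case False
  then show ?thesis by (simp add: gegenbauer_moment_def integral_coordinate_power_odd)
next
  case True
  then obtain l where k: "k = 2 * l" by (rule evenE)
  have "(\<integral>u. (u $ a) ^ (2 * l) \<partial>(sphere_measure :: (real^'m) measure)) = gegenbauer_moment CARD('m) (2 * l) 0"
  proof (induction l)
    case 0
    have "measure sphere_measure (space (sphere_measure :: (real^'m) measure)) = 1"
      by (simp add: measure_def emeasure_sphere_measure_space)
    then show ?case by (simp add: gegenbauer_moment_def)
  next
    case (Suc l)
    have pos: "real CARD('m) + 2 * real l > 0" by (simp add: add_pos_nonneg)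
    have "(\<integral>u. (u $ a) ^ (2 * Suc l) \<partial>(sphere_measure :: (real^'m) measure)) =
        (2 * real l + 1) * gegenbauer_moment CARD('m) (2 * l) 0 / (real CARD('m) + 2 * real l)"
      using integral_coordinate_power_step[of "Suc l" a] Suc.IH pos
      by (simp add: field_simps)
    also have "\<dots> = gegenbauer_moment CARD('m) (2 * Suc l) 0"
    proof -
      have "(2 + 2 * real l) * (1 + 2 * real l) * fact (2 * l) = (fact (2 * Suc l) :: real)"
        by (simp add: algebra_simps)
      then show ?thesis
        using pos by (simp add: gegenbauer_moment_def divide_simps prod_pos del: fact_Suc mult_Suc_right)
          (simp add: algebra_simps)
    qed
    finally show ?case .
  qed
  then show ?thesis by (simp add: k)
qed

lemma integral_inner_power:
  fixes x :: "real^'m::finite"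
  shows "(\<integral>u. (x \<bullet> u) ^ k \<partial>sphere_measure) = norm x ^ k * gegenbauer_moment CARD('m) k 0"
  by (simp add: integral_inner_power_scale[of _ _ undefined] integral_coordinate_power)

lemma gegenbauer_moment_0: "gegenbauer_moment m 0 j = (if j = 0 then 1 else 0)"
  by (simp add: gegenbauer_moment_def)

text \<open>This is the Gegenbauer recurrence \<open>u P_j = r P_(j-1) + (1 - r) P_(j+1)\<close>,
  \<open>r = j / (m + 2j - 2)\<close>, integrated against \<open>u ^ k\<close>; the proof checks it
  on the closed form.\<close>

lemma gegenbauer_moment_Suc:
  assumes "1 \<le> m"
  shows "gegenbauer_moment m (Suc k) j =
    real j / (real m + 2 * real j - 2) * gegenbauer_moment m k (j - 1) +
    (1 - real j / (real m + 2 * real j - 2)) * gegenbauer_moment m k (Suc j)"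
proof (cases "j \<le> Suc k \<and> even (Suc k - j)")
  case False
  then show ?thesis by (cases j) (auto simp: gegenbauer_moment_def)
next
  case True
  then obtain s where k: "Suc k = j + 2 * s" by (metis evenE le_add_diff_inverse)
  define r where "r = real j / (real m + 2 * real j - 2)"
  \<comment> \<open>Only at \<open>j = 0\<close> can the denominator fail to be positive, and there
    both sides are 0.\<close>
  have r: "r * (real m + 2 * real j - 2) = real j"
    unfolding r_def by (cases "j = 0") (use assms in auto)
  define D where "D n = (\<Prod>i<n. real m + 2 * real i)" for n
  have D: "D n > 0" for n unfolding D_def by (intro prod_pos) (use assms in auto)
  have DSuc: "D (Suc n) = D n * (real m + 2 * real n)" for n by (simp add: D_def)
  have fk: "fact (Suc k) = (real j + 2 * real s) * (fact k :: real)"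
    using k by (metis fact_Suc of_nat_add of_nat_mult of_nat_numeral)
  \<comment> \<open>Since \<open>k = (j - 1) + 2s = (j + 1) + 2(s - 1)\<close>, the lower neighbour
    keeps \<open>s\<close>, while the upper one has \<open>s - 1\<close> or vanishes when
    \<open>s = 0\<close>.\<close>
  have low: "r * gegenbauer_moment m k (j - 1) = r * (fact k / (2 ^ s * fact s * D (j + s - 1)))"
  proof (cases j)
    case (Suc i)
    then have "k = i + 2 * s" using k by simp
    then show ?thesis by (simp add: gegenbauer_moment_def D_def Suc)
  qed (simp add: r_def)
  have high: "gegenbauer_moment m k (Suc j) * (2 ^ s * fact s * D (j + s)) = fact k * (2 * real s)"
  proof (cases s)
    case 0
    then show ?thesis using k by (simp add: gegenbauer_moment_def)
  next
    case (Suc i)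
    then have "k = Suc j + 2 * i" using k by simp
    then have "gegenbauer_moment m k (Suc j) = fact k / (2 ^ i * fact i * D (j + s))"
      by (simp add: gegenbauer_moment_def Suc D_def)
    then show ?thesis using D[of "j + s"] by (simp add: Suc)
  qed
  have "gegenbauer_moment m (Suc k) j * (2 ^ s * fact s * D (j + s)) = (real j + 2 * real s) * fact k"
    using k D[of "j + s"] fk by (simp add: gegenbauer_moment_def D_def[symmetric] del: fact_Suc)
  \<comment> \<open>By \<open>r * (m + 2j - 2) = j\<close> the two factors combine to
    \<open>j + 2s\<close>; the terms in \<open>2s * r\<close> cancel.\<close>
  also have "\<dots> = r * (fact k * (real m + 2 * real j + 2 * real s - 2)) + (1 - r) * (fact k * (2 * real s))"
    using r by (simp add: algebra_simps) (metis distrib_left distrib_right mult.commute mult.left_commute)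
  also have "r * (fact k * (real m + 2 * real j + 2 * real s - 2)) =
      r * gegenbauer_moment m k (j - 1) * (2 ^ s * fact s * D (j + s))"
  proof (cases "j = 0")
    case False
    then have "D (j + s) = D (j + s - 1) * (real m + 2 * real j + 2 * real s - 2)"
      using DSuc[of "j + s - 1"] by (simp add: of_nat_diff)
    then show ?thesis unfolding low using D[of "j + s - 1"] by simp
  qed (simp add: r_def)
  finally have "gegenbauer_moment m (Suc k) j * (2 ^ s * fact s * D (j + s)) =
      (r * gegenbauer_moment m k (j - 1) + (1 - r) * gegenbauer_moment m k (Suc j)) * (2 ^ s * fact s * D (j + s))"
    unfolding distrib_right using high by (simp add: mult.assoc)
  then show ?thesis using D[of "j + s"] unfolding r_def by simp
qed

section \<open>Designs and inner product moments\<close>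

text \<open>Words of length \<open>k\<close> index the coordinates of the \<open>k\<close>-th tensor
  power, so \<open>(x \<bullet> y) ^ k\<close> expands without multinomial coefficients.\<close>

definition word_monomial :: "'m list \<Rightarrow> real^'m::finite \<Rightarrow> real" where
  "word_monomial w x = (\<Prod>i\<leftarrow>w. x $ i)"

lemma finite_words: "finite {w :: 'm::finite list. length w = k}"
  using finite_lists_length_eq[of "UNIV :: 'm set" k] by simp

lemma sum_words_Suc:
  fixes f :: "'m::finite list \<Rightarrow> 'b::comm_monoid_add"
  shows "(\<Sum>w | length w = Suc k. f w) = (\<Sum>i\<in>UNIV. \<Sum>w | length w = k. f (i # w))"
proof -
  have "{w :: 'm list. length w = Suc k} = (\<lambda>(i, w). i # w) ` (UNIV \<times> {w. length w = k})"
    by (auto simp: length_Suc_conv)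
  moreover have "inj_on (\<lambda>(i, w). i # w) (UNIV \<times> {w :: 'm list. length w = k})"
    by (auto simp: inj_on_def)
  ultimately show ?thesis
    by (simp add: sum.reindex sum.cartesian_product case_prod_unfold comp_def)
qed

lemma inner_power_eq_sum_words:
  fixes x y :: "real^'m::finite"
  shows "(x \<bullet> y) ^ k = (\<Sum>w | length w = k. word_monomial w x * word_monomial w y)"
proof (induction k)
  case 0
  then show ?case by (simp add: word_monomial_def)
next
  case (Suc k)
  have "(x \<bullet> y) ^ Suc k = (\<Sum>i\<in>UNIV. x $ i * y $ i) * (\<Sum>w | length w = k. word_monomial w x * word_monomial w y)"
    unfolding power_Suc Suc by (simp add: inner_vec_def)
  also have "\<dots> = (\<Sum>w | length w = Suc k. word_monomial w x * word_monomial w y)"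
    unfolding sum_words_Suc sum_product
    by (intro sum.cong refl) (simp add: word_monomial_def mult_ac)
  finally show ?case .
qed

lemma continuous_on_word_monomial: "continuous_on S (word_monomial w)"
  unfolding word_monomial_def by (induction w) (auto intro!: continuous_intros)

lemma word_monomial_eq_prod:
  fixes x :: "real^'m::finite"
  shows "word_monomial w x = (\<Prod>i\<in>UNIV. (x $ i) ^ count_list w i)"
proof (induction w)
  case Nil
  then show ?case by (simp add: word_monomial_def)
next
  case (Cons a w)
  have "(\<Prod>i\<in>UNIV. (x $ i) ^ count_list (a # w) i) =
      (\<Prod>i\<in>UNIV. (if i = a then x $ i else 1) * (x $ i) ^ count_list w i)"
    by (intro prod.cong) auto
  also have "\<dots> = x $ a * (\<Prod>i\<in>UNIV. (x $ i) ^ count_list w i)"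
    by (simp add: prod.distrib)
  finally show ?case using Cons by (simp add: word_monomial_def)
qed

lemma sum_count_list_UNIV: "sum (count_list w) (UNIV :: 'm::finite set) = length w"
  by (rule sum_count_set) simp_all

text \<open>Shows that word monomials exhaust all monomials; the induction strips one letter of
  positive exponent at a time.\<close>

lemma exists_word_count_list:
  fixes \<alpha> :: "'m::finite \<Rightarrow> nat"
  shows "\<exists>w. count_list w = \<alpha>"
proof (induction "sum \<alpha> UNIV" arbitrary: \<alpha>)
  case 0
  then have "count_list [] = \<alpha>" by (auto simp: fun_eq_iff)
  then show ?case ..
next
  case (Suc n)
  then obtain i where i: "\<alpha> i > 0" by (metis gr0I sum.neutral nat.distinct(1))
  have "sum \<alpha> UNIV = Suc (sum (\<alpha>(i := \<alpha> i - 1)) UNIV)"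
    using i by (simp add: sum.remove[of UNIV i] sum.cong[of "UNIV - {i}" _ "\<alpha>(i := \<alpha> i - 1)" \<alpha>])
  then obtain w where "count_list w = \<alpha>(i := \<alpha> i - 1)" using Suc by (metis nat.inject)
  then have "count_list (i # w) = \<alpha>" using i by (auto simp: fun_eq_iff)
  then show ?case ..
qed

lemma polynomial_of_degree_le_word_monomial:
  fixes w :: "'m::finite list"
  assumes "length w \<le> t"
  shows "polynomial_of_degree_le t (word_monomial w)"
  unfolding polynomial_of_degree_le_def
proof (intro exI allI)
  fix x :: "real^'m"
  have "(\<Sum>\<alpha> | sum \<alpha> UNIV \<le> t. (if \<alpha> = count_list w then 1 else 0) * (\<Prod>i\<in>UNIV. (x $ i) ^ \<alpha> i)) =
      (\<Sum>\<alpha> | sum \<alpha> UNIV \<le> t. if \<alpha> = count_list w then (\<Prod>i\<in>UNIV. (x $ i) ^ \<alpha> i) else 0)"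
    by (intro sum.cong) auto
  also have "\<dots> = word_monomial w x"
    using assms finite_exponents[of t, where ?'m = 'm]
    by (simp add: word_monomial_eq_prod sum_count_list_UNIV)
  finally show "word_monomial w x =
      (\<Sum>\<alpha> | sum \<alpha> UNIV \<le> t. (if \<alpha> = count_list w then 1 else 0) * (\<Prod>i\<in>UNIV. (x $ i) ^ \<alpha> i))" ..
qed

text \<open>Average and integral are both linear in \<open>f\<close>, and polynomials of degree at
  most \<open>t\<close> are combinations of word monomials of length at most
  \<open>t\<close>.\<close>

lemma spherical_design_iff_word_monomials:
  fixes Y :: "(real^'m::finite) set"
  shows "spherical_design t Y \<longleftrightarrow>
    finite Y \<and> Y \<noteq> {} \<and> Y \<subseteq> sphere 0 1 \<and>
    (\<forall>w. length w \<le> t \<longrightarrow>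
      (\<Sum>y\<in>Y. word_monomial w y) / real (card Y) = (\<integral>x. word_monomial w x \<partial>sphere_measure))"
    (is "_ \<longleftrightarrow> _ \<and> _ \<and> _ \<and> ?words")
proof -
  have "(\<Sum>y\<in>Y. f y) / real (card Y) = (\<integral>x. f x \<partial>sphere_measure)"
    if words: ?words and poly: "polynomial_of_degree_le t f" for f
  proof -
    let ?A = "{\<alpha> :: 'm \<Rightarrow> nat. sum \<alpha> UNIV \<le> t}"
    obtain c where f: "\<And>x. f x = (\<Sum>\<alpha>\<in>?A. c \<alpha> * (\<Prod>i\<in>UNIV. (x $ i) ^ \<alpha> i))"
      using poly unfolding polynomial_of_degree_le_def by blast
    obtain word where word: "\<And>\<alpha> :: 'm \<Rightarrow> nat. count_list (word \<alpha>) = \<alpha>"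
      using exists_word_count_list by metis
    have f: "f x = (\<Sum>\<alpha>\<in>?A. c \<alpha> * word_monomial (word \<alpha>) x)" for x
      by (simp add: f word_monomial_eq_prod word)
    have len: "length (word \<alpha>) = sum \<alpha> UNIV" for \<alpha>
      using sum_count_list_UNIV[of "word \<alpha>"] by (simp add: word)
    have "(\<Sum>y\<in>Y. f y) / real (card Y) = (\<Sum>\<alpha>\<in>?A. c \<alpha> * ((\<Sum>y\<in>Y. word_monomial (word \<alpha>) y) / real (card Y)))"
      unfolding f by (subst sum.swap) (simp add: sum_divide_distrib sum_distrib_left)
    also have "\<dots> = (\<Sum>\<alpha>\<in>?A. \<integral>x. c \<alpha> * word_monomial (word \<alpha>) x \<partial>sphere_measure)"
      by (intro sum.cong refl) (simp add: words len)
    also have "\<dots> = (\<integral>x. f x \<partial>sphere_measure)"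
      unfolding f by (intro Bochner_Integration.integral_sum[symmetric] integrable_sphere_measure
          continuous_intros continuous_on_word_monomial)
    finally show ?thesis .
  qed
  then show ?thesis
    unfolding spherical_design_def using polynomial_of_degree_le_word_monomial by blast
qed

text \<open>The squared distance between the \<open>k\<close>-th moment tensors of \<open>Y\<close> and of the sphere.\<close>

lemma sum_words_moment_difference_square:
  fixes Y :: "(real^'m::finite) set"
  assumes Y: "finite Y" "Y \<noteq> {}" "Y \<subseteq> sphere 0 1"
  shows "(\<Sum>w | length w = k.
      ((\<Sum>y\<in>Y. word_monomial w y) / real (card Y) - (\<integral>u. word_monomial w u \<partial>sphere_measure))\<^sup>2) =
    (\<Sum>x\<in>Y. \<Sum>y\<in>Y. (x \<bullet> y) ^ k) / (real (card Y))\<^sup>2 - gegenbauer_moment CARD('m) k 0"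
proof -
  let ?W = "{w :: 'm list. length w = k}"
  let ?\<mu> = "gegenbauer_moment CARD('m) k 0"
  define A where "A w = (\<Sum>y\<in>Y. word_monomial w y) / real (card Y)" for w
  define S where "S w = (\<integral>u. word_monomial w u \<partial>(sphere_measure :: (real^'m) measure))" for w
  note int = integrable_sphere_measure continuous_intros continuous_on_word_monomial
  have card: "real (card Y) \<noteq> 0" using Y by simp
  \<comment> \<open>By rotation invariance this pairing is the same for all unit vectors, so the
    mixed term and the sphere's own term below both equal \<open>?\<mu>\<close>.\<close>
  have S: "(\<Sum>w\<in>?W. word_monomial w x * S w) = ?\<mu>" if "norm x = 1" for x
  proof -
    have "(\<Sum>w\<in>?W. word_monomial w x * S w) = (\<Sum>w\<in>?W. \<integral>u. word_monomial w x * word_monomial w u \<partial>sphere_measure)"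
      by (simp add: S_def)
    also have "\<dots> = (\<integral>u. (x \<bullet> u) ^ k \<partial>sphere_measure)"
      unfolding inner_power_eq_sum_words
      by (intro Bochner_Integration.integral_sum[symmetric] int)
    also have "\<dots> = ?\<mu>" by (simp add: integral_inner_power that)
    finally show ?thesis .
  qed
  have AA: "(\<Sum>w\<in>?W. A w * A w) = (\<Sum>x\<in>Y. \<Sum>y\<in>Y. (x \<bullet> y) ^ k) / (real (card Y))\<^sup>2"
  proof -
    have "(\<Sum>w\<in>?W. A w * A w) = (\<Sum>w\<in>?W. \<Sum>x\<in>Y. \<Sum>y\<in>Y. word_monomial w x * word_monomial w y) / (real (card Y))\<^sup>2"
      by (simp add: A_def sum_product sum_divide_distrib power2_eq_square)
    also have "(\<Sum>w\<in>?W. \<Sum>x\<in>Y. \<Sum>y\<in>Y. word_monomial w x * word_monomial w y) = (\<Sum>x\<in>Y. \<Sum>w\<in>?W. \<Sum>y\<in>Y. word_monomial w x * word_monomial w y)"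
      by (rule sum.swap)
    also have "\<dots> = (\<Sum>x\<in>Y. \<Sum>y\<in>Y. (x \<bullet> y) ^ k)"
      unfolding inner_power_eq_sum_words by (intro sum.cong refl sum.swap)
    finally show ?thesis .
  qed
  have AS: "(\<Sum>w\<in>?W. A w * S w) = ?\<mu>"
  proof -
    have "(\<Sum>w\<in>?W. A w * S w) = (\<Sum>w\<in>?W. \<Sum>y\<in>Y. word_monomial w y * S w) / real (card Y)"
      by (simp add: A_def sum_divide_distrib sum_distrib_right)
    also have "(\<Sum>w\<in>?W. \<Sum>y\<in>Y. word_monomial w y * S w) = (\<Sum>y\<in>Y. \<Sum>w\<in>?W. word_monomial w y * S w)"
      by (rule sum.swap)
    also have "\<dots> = (\<Sum>y\<in>Y. ?\<mu>)"
      by (rule sum.cong) (use Y(3) S in auto)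
    finally show ?thesis using card by simp
  qed
  have SS: "(\<Sum>w\<in>?W. S w * S w) = ?\<mu>"
  proof -
    have "(\<Sum>w\<in>?W. S w * S w) = (\<Sum>w\<in>?W. \<integral>u. word_monomial w u * S w \<partial>sphere_measure)"
      by (simp add: S_def)
    also have "\<dots> = (\<integral>u. (\<Sum>w\<in>?W. word_monomial w u * S w) \<partial>sphere_measure)"
      by (intro Bochner_Integration.integral_sum[symmetric] int)
    also have "\<dots> = (\<integral>u. ?\<mu> \<partial>(sphere_measure :: (real^'m) measure))"
    proof (rule Bochner_Integration.integral_cong_AE)
      show "AE u in sphere_measure. (\<Sum>w\<in>?W. word_monomial w u * S w) = ?\<mu>"
        using AE_sphere_measure_norm by eventually_elim (rule S)
    qed (intro borel_measurable_integrable int)+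
    also have "\<dots> = ?\<mu>"
      by (simp add: measure_def emeasure_sphere_measure_space)
    finally show ?thesis .
  qed
  have "(\<Sum>w\<in>?W. (A w - S w)\<^sup>2) = (\<Sum>w\<in>?W. A w * A w - 2 * (A w * S w) + S w * S w)"
    by (simp add: power2_eq_square algebra_simps)
  also have "\<dots> = (\<Sum>w\<in>?W. A w * A w) - 2 * (\<Sum>w\<in>?W. A w * S w) + (\<Sum>w\<in>?W. S w * S w)"
    by (simp add: sum.distrib sum_subtractf sum_distrib_left)
  finally show ?thesis unfolding AA AS SS by (simp add: A_def S_def)
qed

text \<open>A sum of squares vanishes iff each term does, so a single scalar moment of order
  \<open>k\<close> tests all monomials of degree \<open>k\<close> at once.\<close>

lemma spherical_design_iff_inner_power_sums:
  fixes Y :: "(real^'m::finite) set"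
  assumes Y: "finite Y" "Y \<noteq> {}" "Y \<subseteq> sphere 0 1"
  shows "spherical_design t Y \<longleftrightarrow>
    (\<forall>k\<le>t. (\<Sum>x\<in>Y. \<Sum>y\<in>Y. (x \<bullet> y) ^ k) / (real (card Y))\<^sup>2 = gegenbauer_moment CARD('m) k 0)"
proof -
  let ?D = "\<lambda>w. (\<Sum>y\<in>Y. word_monomial w y) / real (card Y) - (\<integral>u. word_monomial w u \<partial>sphere_measure)"
  have "(\<Sum>x\<in>Y. \<Sum>y\<in>Y. (x \<bullet> y) ^ k) / (real (card Y))\<^sup>2 = gegenbauer_moment CARD('m) k 0 \<longleftrightarrow>
      (\<forall>w. length w = k \<longrightarrow> ?D w = 0)" for k
    using sum_words_moment_difference_square[OF Y, of k]
      sum_nonneg_eq_0_iff[OF finite_words[of k], of "\<lambda>w. (?D w)\<^sup>2"] by auto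
  then show ?thesis
    unfolding spherical_design_iff_word_monomials using Y by auto
qed

section \<open>Tridiagonal recurrences\<close>

text \<open>
  \<open>w k j\<close> is the \<open>j\<close>-th coefficient of \<open>x\<^sup>k\<close> in a basis in which multiplication by \<open>x\<close> is tridiagonal,
  with entries \<open>c\<close>, \<open>a\<close>, \<open>b\<close>.
\<close>

definition tridiagonal_array ::
    "nat \<Rightarrow> (nat \<Rightarrow> real) \<Rightarrow> (nat \<Rightarrow> real) \<Rightarrow> (nat \<Rightarrow> real) \<Rightarrow> (nat \<Rightarrow> nat \<Rightarrow> real) \<Rightarrow> bool" where
  "tridiagonal_array d a b c w \<longleftrightarrow>
     w 0 0 = 1 \<and> c 0 = 0 \<and> (\<forall>k j. k < j \<longrightarrow> w k j = 0) \<and>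
     (\<forall>k j. j \<le> d \<longrightarrow> w (Suc k) j = c j * w k (j - 1) + a j * w k j + b j * w k (Suc j))"

text \<open>\<open>w k j\<close> is a weighted count of paths from 0 to \<open>j\<close> in
  \<open>k\<close> steps. Such a path reaches height \<open>i\<close> only if
  \<open>2 * i \<le> k + j\<close>, and a level step at \<open>i\<close> or a descent from
  \<open>i + 1\<close> costs one or two more. The bound on \<open>t\<close> keeps all heights within
  \<open>d\<close>.\<close>

lemma tridiagonal_array_cong:
  assumes w: "tridiagonal_array d a b c w" and w': "tridiagonal_array d a' b' c' w'"
    and t: "t \<le> 2 * d"
    and a: "\<And>i. 2 * i + 1 \<le> t \<Longrightarrow> a i = a' i"
    and b: "\<And>i. 2 * i + 2 \<le> t \<Longrightarrow> b i = b' i"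
    and c: "\<And>i. 2 * i \<le> t \<Longrightarrow> c i = c' i"
    and kj: "k + j \<le> t"
  shows "w k j = w' k j"
  using kj
proof (induction k arbitrary: j)
  case 0
  then show ?case using w w' by (cases "j = 0") (auto simp: tridiagonal_array_def)
next
  case (Suc k)
  show ?case
  proof (cases "j \<le> Suc k")
    case False
    then show ?thesis using w w' by (auto simp: tridiagonal_array_def)
  next
    case True
    then have jd: "j \<le> d" "2 * j \<le> t" using Suc.prems t by simp_all
    have "c j * w k (j - 1) = c' j * w' k (j - 1)"
      using Suc c[OF jd(2)] by simp
    moreover have "a j * w k j = a' j * w' k j"
    proof (cases "j \<le> k")
      case True
      then show ?thesis using Suc a[of j] by simp
    qed (use w w' in \<open>auto simp: tridiagonal_array_def\<close>)
    moreover have "b j * w k (Suc j) = b' j * w' k (Suc j)"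
    proof (cases "Suc j \<le> k")
      case True
      then show ?thesis using Suc b[of j] by simp
    qed (use w w' in \<open>auto simp: tridiagonal_array_def\<close>)
    ultimately show ?thesis using w w' jd by (simp add: tridiagonal_array_def)
  qed
qed

lemma tridiagonal_array_diagonal:
  assumes "tridiagonal_array d a b c w" and "k < d"
  shows "w (Suc k) (Suc k) = c (Suc k) * w k k"
  using assms by (auto simp: tridiagonal_array_def)

text \<open>Only one path climbs from 0 to \<open>k\<close> in \<open>k\<close> steps, so the
  diagonal entry is \<open>c 1 * ... * c k\<close>.\<close>

lemma tridiagonal_array_diagonal_nonzero:
  assumes "tridiagonal_array d a b c w" and "\<And>j. 1 \<le> j \<Longrightarrow> j \<le> d \<Longrightarrow> c j \<noteq> 0" and "k \<le> d"
  shows "w k k \<noteq> 0"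
  using assms(3)
proof (induction k)
  case 0
  then show ?case using assms(1) by (simp add: tridiagonal_array_def)
next
  case (Suc k)
  then show ?case using tridiagonal_array_diagonal[OF assms(1), of k] assms(2)[of "Suc k"] by simp
qed

text \<open>
  Only coefficients of index at most \<open>(k + j) / 2\<close> enter \<open>w k j\<close>, so agreement of \<open>w (Suc t) 0\<close> propagates
  along the antidiagonal \<open>k + j = Suc t\<close> down to the diagonal, where the next coefficient is read off.
\<close>

lemma tridiagonal_array_moments_eq_iff:
  assumes w: "tridiagonal_array d a b c w" and w': "tridiagonal_array d a' b' c' w'"
    and b: "\<And>i. i \<le> d \<Longrightarrow> b i = s - a i - c i" and b': "\<And>i. i \<le> d \<Longrightarrow> b' i = s - a' i - c' i"
    and b0: "\<And>i. i < d \<Longrightarrow> b i \<noteq> 0" and c0: "\<And>i. 1 \<le> i \<Longrightarrow> i \<le> d \<Longrightarrow> c i \<noteq> 0"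
    and t: "t \<le> 2 * d"
  shows "(\<forall>k\<le>t. w k 0 = w' k 0) \<longleftrightarrow>
    (\<forall>i. 2 * i + 1 \<le> t \<longrightarrow> a i = a' i) \<and> (\<forall>i. 2 * i \<le> t \<longrightarrow> c i = c' i)"
    (is "?moments t \<longleftrightarrow> ?coeffs t")
proof
  have local: "w k j = w' k j" if coeffs: "?coeffs n" and n: "n \<le> 2 * d" and kj: "k + j \<le> n" for n k j
  proof (rule tridiagonal_array_cong[OF w w' n _ _ _ kj])
    fix i assume "2 * i + 2 \<le> n"
    then show "b i = b' i" using coeffs n b[of i] b'[of i] by simp
  qed (use coeffs in auto)
  then show "?moments t" if "?coeffs t" using that t by simp
  show "?coeffs t" if "?moments t"
    using that t
  proof (induction t)
    case 0
    then show ?case using w w' by (auto simp: tridiagonal_array_def)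
  next
    case (Suc t)
    then have coeffs: "?coeffs t" and td: "t < 2 * d" by auto
    then have low: "w k j = w' k j" if "k + j \<le> t" for k j using that local[of t] by simp
    have anti: "w (Suc t - j) j = w' (Suc t - j) j" if "2 * j \<le> Suc t" for j
      using that
    proof (induction j)
      case 0
      then show ?case using Suc.prems by simp
    next
      case (Suc j)
      then have jt: "2 * j + 1 \<le> t" and j: "j < d" using td by auto
      then have eq: "a j = a' j" "c j = c' j" using coeffs by auto
      then have beq: "b j = b' j" using b[of j] b'[of j] j by simp
      let ?k = "t - j"
      have k: "Suc t - j = Suc ?k" "Suc t - Suc j = ?k" using jt by auto
      have rec: "w (Suc ?k) j = c j * w ?k (j - 1) + a j * w ?k j + b j * w ?k (Suc j)"
        "w' (Suc ?k) j = c' j * w' ?k (j - 1) + a' j * w' ?k j + b' j * w' ?k (Suc j)"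
        using w w' j by (simp_all add: tridiagonal_array_def)
      have "w (Suc ?k) j = w' (Suc ?k) j" using Suc k by simp
      moreover have "w ?k (j - 1) = w' ?k (j - 1)" "w ?k j = w' ?k j" using jt by (auto intro: low)
      \<comment> \<open>All other terms of the recurrence already agree;
        \<open>b j \<noteq> 0\<close> then yields the next entry of the antidiagonal.\<close>
      ultimately have "b j * w ?k (Suc j) = b j * w' ?k (Suc j)" using rec eq beq by simp
      then show ?case using b0[OF j] k by simp
    qed
    show ?case
    \<comment> \<open>The antidiagonal stops at \<open>w (n + 1) n\<close> for
      \<open>t = 2 * n\<close>, where \<open>a n\<close> is the only unknown, and at
      \<open>w (n + 1) (n + 1)\<close> for \<open>t = 2 * n + 1\<close>, where it is
      \<open>c (n + 1)\<close>.\<close>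
    proof (cases "even t")
      case True
      then obtain n where n: "t = 2 * n" by (rule evenE)
      then have nd: "n < d" using td by simp
      have dia: "w n n = w' n n" and dia1: "w n (n - 1) = w' n (n - 1)" by (auto intro: low simp: n)
      have cn: "c n = c' n" using coeffs n by simp
      have "w (Suc n) n = w' (Suc n) n" using anti[of n] by (simp add: n Suc_diff_le)
      then have "a n * w n n = a' n * w n n"
        using w w' nd dia dia1 cn by (simp add: tridiagonal_array_def)
      then have "a n = a' n" using tridiagonal_array_diagonal_nonzero[OF w c0, of n] nd by simp
      moreover have "2 * i + 1 \<le> Suc t \<Longrightarrow> i = n \<or> 2 * i + 1 \<le> t" "2 * i \<le> Suc t \<Longrightarrow> 2 * i \<le> t" for i
        using n by presburger+
      ultimately show ?thesis using coeffs by metis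
    next
      case False
      then obtain n where n: "t = 2 * n + 1" by (rule oddE)
      then have nd: "n < d" using td by simp
      have dia: "w n n = w' n n" by (auto intro: low simp: n)
      have "w (Suc n) (Suc n) = w' (Suc n) (Suc n)" using anti[of "Suc n"] by (simp add: n)
      then have "c (Suc n) * w n n = c' (Suc n) * w n n"
        using tridiagonal_array_diagonal[OF w nd] tridiagonal_array_diagonal[OF w' nd] dia by simp
      then have "c (Suc n) = c' (Suc n)"
        using tridiagonal_array_diagonal_nonzero[OF w c0, of n] nd by simp
      moreover have "2 * i \<le> Suc t \<Longrightarrow> i = Suc n \<or> 2 * i \<le> t" "2 * i + 1 \<le> Suc t \<Longrightarrow> 2 * i + 1 \<le> t" for i
        using n by presburger+
      ultimately show ?thesis using coeffs by metis
    qed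
  qed
qed

text \<open>The factor \<open>m ^ k\<close> matches the scheme, where the entries of
  \<open>|X| E_1\<close> are \<open>m\<close> times inner products; it raises the sum of the three
  coefficients from 1 to \<open>m\<close>.\<close>

lemma tridiagonal_array_gegenbauer_moment:
  assumes "1 \<le> m"
  shows "tridiagonal_array d (\<lambda>_. 0) (\<lambda>j. real m - real m * real j / (real m + 2 * real j - 2))
    (\<lambda>j. real m * real j / (real m + 2 * real j - 2)) (\<lambda>k j. real m ^ k * gegenbauer_moment m k j)"
proof -
  have "real m ^ Suc k * gegenbauer_moment m (Suc k) j =
      real m * real j / (real m + 2 * real j - 2) * (real m ^ k * gegenbauer_moment m k (j - 1)) +
      (real m - real m * real j / (real m + 2 * real j - 2)) * (real m ^ k * gegenbauer_moment m k (Suc j))" for k j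
  proof -
    define r where "r = real j / (real m + 2 * real j - 2)"
    have r: "real m * real j / (real m + 2 * real j - 2) = real m * r" by (simp add: r_def)
    show ?thesis
      unfolding gegenbauer_moment_Suc[OF assms] r unfolding r_def[symmetric] by (simp add: algebra_simps)
  qed
  moreover have "gegenbauer_moment m k j = 0" if "k < j" for k j
    using that by (simp add: gegenbauer_moment_def)
  ultimately show ?thesis
    unfolding tridiagonal_array_def by (simp add: gegenbauer_moment_0)
qed

section \<open>Association schemes\<close>

lemma adjacency_diagonal:
  fixes R :: "nat \<Rightarrow> ('x::finite \<times> 'x) set"
  assumes "symmetric_association_scheme d R" and "i \<le> d"
  shows "adjacency (R i) $ x $ x = (if i = 0 then 1 else 0)"
proof (cases "i = 0")
  case True
  then show ?thesis using assms(1) by (simp add: symmetric_association_scheme_def mat_def)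
next
  case False
  have "adjacency (R 0) $ x $ x = 1"
    using assms(1) by (simp add: symmetric_association_scheme_def mat_def)
  then have "(x, x) \<in> R 0" by (simp add: adjacency_def split: if_splits)
  moreover have "R 0 \<inter> R i = {}"
    using assms False by (auto simp: symmetric_association_scheme_def disjoint_family_on_def)
  ultimately show ?thesis using False by (auto simp: adjacency_def)
qed

lemma bose_mesner_diagonal:
  fixes R :: "nat \<Rightarrow> ('x::finite \<times> 'x) set"
  assumes "symmetric_association_scheme d R" and "A \<in> bose_mesner d R"
  shows "A $ x $ x = A $ y $ y"
proof -
  have "bose_mesner d R \<subseteq> {A. A $ x $ x = A $ y $ y}"
    unfolding bose_mesner_def
    by (rule span_minimal) (auto simp: subspace_def adjacency_diagonal[OF assms(1)])
  then show ?thesis using assms(2) by blast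
qed

lemma bose_mesner_symmetric:
  fixes R :: "nat \<Rightarrow> ('x::finite \<times> 'x) set"
  assumes "symmetric_association_scheme d R" and "A \<in> bose_mesner d R"
  shows "transpose A = A"
proof -
  have "bose_mesner d R \<subseteq> {A. transpose A = A}"
    unfolding bose_mesner_def
    using assms(1) by (intro span_minimal)
      (auto simp: subspace_def symmetric_association_scheme_def transpose_def vec_eq_iff)
  then show ?thesis using assms(2) by blast
qed

lemma bose_mesner_matrix_mult:
  fixes R :: "nat \<Rightarrow> ('x::finite \<times> 'x) set"
  assumes scheme: "symmetric_association_scheme d R"
    and "A \<in> bose_mesner d R" and "B \<in> bose_mesner d R"
  shows "A ** B \<in> bose_mesner d R"
proof -
  let ?M = "bose_mesner d R"
  have sub: "subspace ?M" unfolding bose_mesner_def by (rule subspace_span)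
  have add: "(C + C') ** D = C ** D + C' ** D" for C C' D :: "real^'x^'x"
    by (simp add: vec_eq_iff matrix_matrix_mult_def sum.distrib distrib_right)
  note alg = matrix_add_ldistrib add
  have scale: "(r *\<^sub>R C) ** D = r *\<^sub>R (C ** D)" "D ** (r *\<^sub>R C) = r *\<^sub>R (D ** C)" for r and C D :: "real^'x^'x"
    by (simp_all add: vec_eq_iff matrix_matrix_mult_def sum_distrib_left mult_ac)
  have zero: "(0 :: real^'x^'x) ** D = 0" "D ** 0 = 0" for D :: "real^'x^'x"
    by (simp_all add: vec_eq_iff matrix_matrix_mult_def)
  have "adjacency (R i) ** B \<in> ?M" if "i \<le> d" for i
  proof -
    have "?M \<subseteq> {B. adjacency (R i) ** B \<in> ?M}"
      unfolding bose_mesner_def using sub that scheme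
      by (intro span_minimal)
        (auto simp: subspace_def alg scale zero symmetric_association_scheme_def simp flip: bose_mesner_def)
    then show ?thesis using assms(3) by blast
  qed
  then have "?M \<subseteq> {A. A ** B \<in> ?M}"
    unfolding bose_mesner_def using sub
    by (intro span_minimal) (auto simp: subspace_def alg scale zero simp flip: bose_mesner_def)
  then show ?thesis using assms(2) by blast
qed

text \<open>All elements of the algebra, products included, are symmetric, so transposing
  \<open>A ** B\<close> reverses the factors without changing it.\<close>

lemma bose_mesner_commute:
  fixes R :: "nat \<Rightarrow> ('x::finite \<times> 'x) set"
  assumes "symmetric_association_scheme d R" and "A \<in> bose_mesner d R" and "B \<in> bose_mesner d R"
  shows "A ** B = B ** A"
  using bose_mesner_symmetric[OF assms(1) bose_mesner_matrix_mult[OF assms]]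
    bose_mesner_symmetric[OF assms(1,2)] bose_mesner_symmetric[OF assms(1,3)]
  by (simp add: matrix_transpose_mul)

lemma primitive_idempotentsD:
  assumes "e \<in> primitive_idempotents \<A>"
  shows "e \<in> \<A>" "e \<noteq> 0" "e ** e = e"
  using assms unfolding primitive_idempotents_def by blast+

text \<open>Commuting idempotents split \<open>g\<close> as \<open>g ** h + (g - g ** h)\<close>, so
  primitivity makes \<open>g ** h\<close> either 0 or \<open>g\<close>. A nonzero product of
  \<open>e\<close> and \<open>f\<close> would thus equal both of them.\<close>

lemma primitive_idempotents_orthogonal:
  fixes R :: "nat \<Rightarrow> ('x::finite \<times> 'x) set"
  assumes scheme: "symmetric_association_scheme d R"
    and e: "e \<in> primitive_idempotents (bose_mesner d R)"
    and f: "f \<in> primitive_idempotents (bose_mesner d R)" and "e \<noteq> f"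
  shows "e ** f = 0"
proof -
  let ?M = "bose_mesner d R"
  have absorb: "g ** h = 0 \<or> g ** h = g"
    if g: "g \<in> primitive_idempotents ?M" and h: "h \<in> primitive_idempotents ?M" for g h
  proof -
    have gM: "g \<in> ?M" and hM: "h \<in> ?M" and gg: "g ** g = g" and hh: "h ** h = h"
      using primitive_idempotentsD[OF g] primitive_idempotentsD[OF h] by blast+
    note comm = bose_mesner_commute[OF scheme gM hM]
    have ghM: "g ** h \<in> ?M" by (rule bose_mesner_matrix_mult[OF scheme gM hM])
    have dM: "g - g ** h \<in> ?M" using gM ghM unfolding bose_mesner_def by (rule span_diff)
    have 1: "(g ** h) ** (g ** h) = g ** h" by (metis comm gg hh matrix_mul_assoc)
    have 2: "g ** (g ** h) = g ** h" by (simp add: matrix_mul_assoc gg)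
    have 3: "(g ** h) ** g = g ** h" by (metis comm gg matrix_mul_assoc)
    have diff: "(g - g ** h) ** k = g ** k - (g ** h) ** k" "k ** (g - g ** h) = k ** g - k ** (g ** h)" for k
      by (simp_all add: vec_eq_iff matrix_matrix_mult_def sum_subtractf algebra_simps)
    have "(g - g ** h) ** (g - g ** h) = g - g ** h" "(g ** h) ** (g - g ** h) = 0" "(g - g ** h) ** (g ** h) = 0"
      by (simp_all only: diff 1 2 3 gg) simp_all
    moreover have "g = g ** h + (g - g ** h)" by simp
    ultimately have "g ** h = 0 \<or> g - g ** h = 0"
      using g ghM dM 1 unfolding primitive_idempotents_def by blast
    then show ?thesis by auto
  qed
  have "e ** f = f ** e"
    by (rule bose_mesner_commute[OF scheme primitive_idempotentsD(1)[OF e] primitive_idempotentsD(1)[OF f]])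
  then show ?thesis using absorb[OF e f] absorb[OF f e] \<open>e \<noteq> f\<close> by metis
qed

text \<open>\<open>d_pos\<close> guarantees that \<open>E 1\<close> is one of the idempotents; in
  the theorem it follows from \<open>1 \<le> t\<close> and \<open>t \<le> 2 * d\<close>.\<close>

locale ordered_scheme =
  fixes d :: nat and R :: "nat \<Rightarrow> ('x::finite \<times> 'x) set" and E :: "nat \<Rightarrow> real^'x^'x"
    and q :: "nat \<Rightarrow> nat \<Rightarrow> nat \<Rightarrow> real"
  assumes scheme: "symmetric_association_scheme d R"
    and ordering: "idempotent_ordering d R E"
    and krein: "krein_parameters d E q"
    and Q_poly: "Q_polynomial d q"
    and d_pos: "1 \<le> d"
begin

section \<open>Orthogonality and traces of the idempotents, symmetry of the Krein parameters\<close>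

lemma idempotent_primitive: "i \<le> d \<Longrightarrow> E i \<in> primitive_idempotents (bose_mesner d R)"
  using ordering by (auto simp: idempotent_ordering_def bij_betw_def)

lemma idempotent_in_algebra: "i \<le> d \<Longrightarrow> E i \<in> bose_mesner d R"
  using idempotent_primitive by (rule primitive_idempotentsD)

lemma idempotent_nonzero: "i \<le> d \<Longrightarrow> E i \<noteq> 0"
  using idempotent_primitive by (rule primitive_idempotentsD)

lemma idempotent_mult: "i \<le> d \<Longrightarrow> j \<le> d \<Longrightarrow> E i ** E j = (if i = j then E i else 0)"
proof (cases "i = j")
  case True
  then show "i \<le> d \<Longrightarrow> ?thesis" using primitive_idempotentsD(3)[OF idempotent_primitive, of i] by simp
next
  case False
  assume "i \<le> d" "j \<le> d"
  moreover from this have "E i \<noteq> E j"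
    using ordering False by (auto simp: idempotent_ordering_def bij_betw_def inj_on_def)
  ultimately show ?thesis
    using primitive_idempotents_orthogonal[OF scheme] idempotent_primitive False by simp
qed

lemma idempotent_symmetric:
  assumes "i \<le> d"
  shows "E i $ x $ y = E i $ y $ x"
proof -
  have "transpose (E i) $ x $ y = E i $ x $ y"
    by (simp add: bose_mesner_symmetric[OF scheme idempotent_in_algebra[OF assms]])
  then show ?thesis by (simp add: transpose_def)
qed

lemma sum_idempotent_mult_row:
  assumes "i \<le> d" "j \<le> d"
  shows "(\<Sum>z\<in>UNIV. E i $ x $ z * E j $ y $ z) = (if i = j then E i $ x $ y else 0)"
proof -
  have "(\<Sum>z\<in>UNIV. E i $ x $ z * E j $ y $ z) = (E i ** E j) $ x $ y"
    by (simp add: matrix_matrix_mult_def idempotent_symmetric[OF assms(2), of y])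
  then show ?thesis by (simp add: idempotent_mult assms)
qed

lemma idempotent_diagonal:
  assumes "i \<le> d"
  shows "E i $ x $ x = trace (E i) / real CARD('x)"
proof -
  have "trace (E i) = (\<Sum>y\<in>(UNIV :: 'x set). E i $ x $ x)"
    unfolding trace_def
    by (intro sum.cong refl bose_mesner_diagonal[OF scheme idempotent_in_algebra[OF assms]])
  then show ?thesis by simp
qed

lemma sum_idempotent_mult:
  assumes "i \<le> d" "j \<le> d"
  shows "(\<Sum>x\<in>UNIV. \<Sum>y\<in>UNIV. E i $ x $ y * E j $ x $ y) = (if i = j then trace (E i) else 0)"
  by (simp add: sum_idempotent_mult_row assms trace_def)

text \<open>A diagonal entry is the squared length of a row, some row is nonzero, and the diagonal
  is constant.\<close>

lemma trace_idempotent_pos: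
  assumes "i \<le> d"
  shows "trace (E i) > 0"
proof -
  obtain x y where xy: "E i $ x $ y \<noteq> 0"
    using idempotent_nonzero[OF assms] by (auto simp: vec_eq_iff)
  have "0 < (\<Sum>z\<in>UNIV. E i $ x $ z * E i $ x $ z)"
    using xy by (intro sum_pos2[of _ y]) (auto simp: zero_less_mult_iff linorder_neq_iff)
  then have "0 < E i $ x $ x" by (simp add: sum_idempotent_mult_row assms)
  then show ?thesis using idempotent_diagonal[OF assms, of x] by (simp add: zero_less_divide_iff)
qed

lemma krein_entry:
  assumes "i \<le> d" "j \<le> d"
  shows "real CARD('x) * (E i $ x $ y * E j $ x $ y) = (\<Sum>k\<le>d. q i j k * E k $ x $ y)"
proof -
  have "hadamard (E i) (E j) $ x $ y = ((1 / real CARD('x)) *\<^sub>R (\<Sum>k\<le>d. q i j k *\<^sub>R E k)) $ x $ y"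
    using krein assms by (simp add: krein_parameters_def)
  then show ?thesis by (simp add: hadamard_def)
qed

text \<open>\<open>q i j k * trace (E k)\<close> is \<open>|X|\<close> times the sum of all entries
  of the entrywise product of \<open>E i\<close>, \<open>E j\<close> and \<open>E k\<close>, which
  is symmetric in the three indices.\<close>

lemma krein_symmetric:
  assumes "i \<le> d" "j \<le> d" "k \<le> d"
  shows "q i j k * trace (E k) = q i k j * trace (E j)"
proof -
  have triple: "q i j k * trace (E k) = (\<Sum>x\<in>UNIV. \<Sum>y\<in>UNIV. real CARD('x) * (E i $ x $ y * E j $ x $ y * E k $ x $ y))"
    if j: "j \<le> d" and k: "k \<le> d" for j k
  proof -
    have "(\<Sum>x\<in>UNIV. \<Sum>y\<in>UNIV. real CARD('x) * (E i $ x $ y * E j $ x $ y * E k $ x $ y)) =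
        (\<Sum>x\<in>UNIV. \<Sum>y\<in>UNIV. \<Sum>l\<le>d. q i j l * (E l $ x $ y * E k $ x $ y))"
      using krein_entry[OF assms(1) j] by (simp add: sum_distrib_right mult.assoc[symmetric])
    also have "\<dots> = (\<Sum>x\<in>UNIV. \<Sum>l\<le>d. \<Sum>y\<in>UNIV. q i j l * (E l $ x $ y * E k $ x $ y))"
      by (intro sum.cong refl sum.swap)
    also have "\<dots> = (\<Sum>l\<le>d. \<Sum>x\<in>UNIV. \<Sum>y\<in>UNIV. q i j l * (E l $ x $ y * E k $ x $ y))"
      by (rule sum.swap)
    also have "\<dots> = (\<Sum>l\<le>d. q i j l * (if l = k then trace (E l) else 0))"
      by (intro sum.cong refl) (simp add: sum_idempotent_mult k flip: sum_distrib_left)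
    also have "\<dots> = q i j k * trace (E k)" using k by (simp add: if_distrib cong: if_cong)
    finally show ?thesis ..
  qed
  show ?thesis
    using assms triple[of j k] triple[of k j] by (simp add: mult_ac)
qed

section \<open>The three-term recurrence for the entries of the idempotents\<close>

lemma krein_zero:
  "i \<le> d \<Longrightarrow> j \<le> d \<Longrightarrow> k \<le> d \<Longrightarrow> i > j + k \<or> j > i + k \<or> k > i + j \<Longrightarrow> q i j k = 0"
  using Q_poly unfolding Q_polynomial_def by blast

lemma krein_pos:
  "i \<le> d \<Longrightarrow> j \<le> d \<Longrightarrow> k \<le> d \<Longrightarrow> i = j + k \<or> j = i + k \<or> k = i + j \<Longrightarrow> q i j k > 0"
  using Q_poly unfolding Q_polynomial_def by blast

text \<open>Nothing is known about \<open>E\<close> and \<open>q\<close> at index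
  \<open>Suc d\<close>; the value 0 truncates the recurrence at \<open>j = d\<close>.\<close>

definition b_star :: "nat \<Rightarrow> real" where
  "b_star j = (if j < d then q 1 (Suc j) j else 0)"

text \<open>The counterpart of the Gegenbauer polynomial \<open>P_j\<close> at the inner product of
  two points, scaled like \<open>P_j(1) = 1\<close>.\<close>

definition normalized_entry :: "nat \<Rightarrow> 'x \<Rightarrow> 'x \<Rightarrow> real" where
  "normalized_entry j x y = real CARD('x) * E j $ x $ y / trace (E j)"

lemma normalized_entry_diagonal: "j \<le> d \<Longrightarrow> normalized_entry j x x = 1"
  using trace_idempotent_pos[of j] idempotent_diagonal[of j x] by (simp add: normalized_entry_def)

text \<open>The triangle condition leaves only \<open>j - 1\<close>, \<open>j\<close>,
  \<open>j + 1\<close> in the Krein expansion of \<open>E 1\<close> times \<open>E j\<close>.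
  Symmetry moves \<open>j\<close> to the upper index, and the normalization absorbs the resulting
  ratios of traces. At \<open>j = 0\<close> the coefficient \<open>c_star q 0 = 0\<close> removes
  the term at \<open>j - 1\<close>.\<close>

lemma normalized_entry_recurrence:
  assumes j: "j \<le> d"
  shows "real CARD('x) * E 1 $ x $ y * normalized_entry j x y =
    c_star q j * normalized_entry (j - 1) x y + a_star q j * normalized_entry j x y +
    b_star j * normalized_entry (Suc j) x y"
proof -
  let ?f = "\<lambda>k. q 1 j k * E k $ x $ y"
  let ?t = "trace (E j)"
  have tj: "?t > 0" by (rule trace_idempotent_pos[OF j])
  have zero: "?f k = 0" if "k \<le> d" "k \<notin> {j - 1, j, Suc j}" for k
  proof -
    have "1 > j + k \<or> j > 1 + k \<or> k > 1 + j" using that by auto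
    then show ?thesis using krein_zero[of 1 j k] that j d_pos by simp
  qed
  have "(\<Sum>k\<le>d. ?f k) = (\<Sum>k\<in>{j - 1, j, Suc j} \<inter> {..d}. ?f k)"
    by (rule sum.mono_neutral_right) (use zero in auto)
  also have "\<dots> = (if j = 0 then 0 else ?f (j - 1)) + ?f j + (if j < d then ?f (Suc j) else 0)"
    using j by (cases j) auto
  finally have sum: "(\<Sum>k\<le>d. ?f k) = (if j = 0 then 0 else ?f (j - 1)) + ?f j + (if j < d then ?f (Suc j) else 0)" .
  have low: "(if j = 0 then 0 else ?f (j - 1)) = c_star q j * ?t / trace (E (j - 1)) * E (j - 1) $ x $ y"
  proof (cases "j = 0")
    case False
    then have "q 1 j (j - 1) * trace (E (j - 1)) = q 1 (j - 1) j * ?t"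
      using j d_pos by (intro krein_symmetric) auto
    moreover have "trace (E (j - 1)) > 0" using j by (intro trace_idempotent_pos) auto
    ultimately show ?thesis using False by (simp add: c_star_def field_simps)
  qed (simp add: c_star_def)
  have high: "(if j < d then ?f (Suc j) else 0) = b_star j * ?t / trace (E (Suc j)) * E (Suc j) $ x $ y"
  proof (cases "j < d")
    case True
    then have "q 1 j (Suc j) * trace (E (Suc j)) = q 1 (Suc j) j * ?t"
      using d_pos by (intro krein_symmetric) auto
    moreover have "trace (E (Suc j)) > 0" using True by (intro trace_idempotent_pos) auto
    ultimately show ?thesis using True by (simp add: b_star_def field_simps)
  qed (simp add: b_star_def)
  have entry: "real CARD('x) * (E 1 $ x $ y * E j $ x $ y) =
      c_star q j * ?t / trace (E (j - 1)) * E (j - 1) $ x $ y + a_star q j * E j $ x $ y +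
      b_star j * ?t / trace (E (Suc j)) * E (Suc j) $ x $ y"
    using krein_entry[OF d_pos j, of x y] unfolding sum low high by (simp add: a_star_def)
  have scale: "real CARD('x) / ?t * (p * ?t / r * e) = p * (real CARD('x) * e / r)" for p r e
    using tj by simp
  have "real CARD('x) * E 1 $ x $ y * normalized_entry j x y =
      real CARD('x) / ?t * (real CARD('x) * (E 1 $ x $ y * E j $ x $ y))"
    by (simp add: normalized_entry_def)
  also have "\<dots> = c_star q j * (real CARD('x) * E (j - 1) $ x $ y / trace (E (j - 1))) +
      real CARD('x) / ?t * (a_star q j * E j $ x $ y) +
      b_star j * (real CARD('x) * E (Suc j) $ x $ y / trace (E (Suc j)))"
    unfolding entry distrib_left scale ..
  finally show ?thesis by (simp add: normalized_entry_def)
qed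

text \<open>On the diagonal all normalized entries are 1, so the recurrence there reads off the sum
  of its coefficients.\<close>

lemma b_star_eq:
  assumes "j \<le> d"
  shows "b_star j = trace (E 1) - a_star q j - c_star q j"
proof -
  have "c_star q j * normalized_entry (j - 1) x x = c_star q j" for x
    using assms by (cases "j = 0") (simp_all add: c_star_def normalized_entry_diagonal)
  moreover have "b_star j * normalized_entry (Suc j) x x = b_star j" for x
    using assms by (cases "j < d") (simp_all add: b_star_def normalized_entry_diagonal)
  ultimately show ?thesis
    using normalized_entry_recurrence[OF assms, of undefined undefined] assms d_pos
    by (simp add: normalized_entry_diagonal idempotent_diagonal)
qed

lemma b_star_pos: "j < d \<Longrightarrow> b_star j > 0"
  using krein_pos[of 1 "Suc j" j] d_pos by (simp add: b_star_def)

lemma c_star_pos: "1 \<le> j \<Longrightarrow> j \<le> d \<Longrightarrow> c_star q j > 0"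
  using krein_pos[of 1 "j - 1" j] d_pos by (simp add: c_star_def)

section \<open>Moments of the scheme\<close>

lemma normalized_entry_0: "normalized_entry 0 x y = 1"
proof -
  have "E 0 $ x $ y = 1 / real CARD('x)" for x y
    using ordering by (simp add: idempotent_ordering_def all_ones_def)
  then show ?thesis by (simp add: normalized_entry_def trace_def)
qed

lemma sum_normalized_entry:
  assumes "1 \<le> j" "j \<le> d"
  shows "(\<Sum>x\<in>UNIV. \<Sum>y\<in>UNIV. normalized_entry j x y) = 0"
proof -
  have "(\<Sum>x\<in>UNIV. \<Sum>y\<in>UNIV. E 0 $ x $ y * E j $ x $ y) = 0"
    using assms sum_idempotent_mult[of 0 j] by simp
  moreover have "E 0 $ x $ y = 1 / real CARD('x)" for x y
    using ordering by (simp add: idempotent_ordering_def all_ones_def)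
  ultimately show ?thesis
    by (simp add: normalized_entry_def flip: sum_divide_distrib sum_distrib_left)
qed

text \<open>The counterpart of \<open>m ^ k * gegenbauer_moment m k j\<close>, averaged over all
  pairs of points. It is 0 beyond \<open>d\<close>, where \<open>E j\<close> is arbitrary.\<close>

definition scheme_moment :: "nat \<Rightarrow> nat \<Rightarrow> real" where
  "scheme_moment k j = (if j \<le> d
     then (\<Sum>x\<in>UNIV. \<Sum>y\<in>UNIV. (real CARD('x) * E 1 $ x $ y) ^ k * normalized_entry j x y) / (real CARD('x))\<^sup>2 else 0)"

lemma scheme_moment_Suc:
  assumes "j \<le> d"
  shows "scheme_moment (Suc k) j =
    c_star q j * scheme_moment k (j - 1) + a_star q j * scheme_moment k j + b_star j * scheme_moment k (Suc j)"
proof -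
  define S where "S i = (\<Sum>x\<in>UNIV. \<Sum>y\<in>UNIV. (real CARD('x) * E 1 $ x $ y) ^ k * normalized_entry i x y)" for i
  have "(real CARD('x) * E 1 $ x $ y) ^ Suc k * normalized_entry j x y =
      c_star q j * ((real CARD('x) * E 1 $ x $ y) ^ k * normalized_entry (j - 1) x y) +
      a_star q j * ((real CARD('x) * E 1 $ x $ y) ^ k * normalized_entry j x y) +
      b_star j * ((real CARD('x) * E 1 $ x $ y) ^ k * normalized_entry (Suc j) x y)" for x y
  proof -
    have "(real CARD('x) * E 1 $ x $ y) ^ Suc k * normalized_entry j x y =
        (real CARD('x) * E 1 $ x $ y) ^ k * (real CARD('x) * E 1 $ x $ y * normalized_entry j x y)"
      by (simp only: power_Suc mult_ac)
    then show ?thesis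
      unfolding normalized_entry_recurrence[OF assms] by (simp only: distrib_left mult_ac)
  qed
  then have "(\<Sum>x\<in>UNIV. \<Sum>y\<in>UNIV. (real CARD('x) * E 1 $ x $ y) ^ Suc k * normalized_entry j x y) =
      c_star q j * S (j - 1) + a_star q j * S j + b_star j * S (Suc j)"
    by (simp only: S_def sum.distrib sum_distrib_left)
  then have "scheme_moment (Suc k) j = (c_star q j * S (j - 1) + a_star q j * S j + b_star j * S (Suc j)) / (real CARD('x))\<^sup>2"
    using assms by (simp only: scheme_moment_def if_True)
  moreover have moment: "scheme_moment k i = S i / (real CARD('x))\<^sup>2" if "i \<le> d" for i
    using that by (simp add: scheme_moment_def S_def)
  moreover have "b_star j * scheme_moment k (Suc j) = b_star j * (S (Suc j) / (real CARD('x))\<^sup>2)"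
    by (cases "j < d") (simp_all add: moment b_star_def)
  ultimately show ?thesis using assms by (simp add: add_divide_distrib)
qed

lemma scheme_moment_0: "scheme_moment 0 j = (if j = 0 then 1 else 0)"
  by (cases "j = 0") (simp_all add: scheme_moment_def normalized_entry_0 sum_normalized_entry power2_eq_square)

lemma tridiagonal_array_scheme_moment:
  "tridiagonal_array d (a_star q) b_star (c_star q) scheme_moment"
proof -
  have "scheme_moment k j = 0" if "k < j" for k j
    using that
  proof (induction k arbitrary: j)
    case 0
    then show ?case by (simp add: scheme_moment_0)
  next
    case (Suc k)
    then show ?case by (cases "j \<le> d") (simp_all add: scheme_moment_Suc, simp add: scheme_moment_def)
  qed
  then show ?thesis
    by (simp add: tridiagonal_array_def scheme_moment_0 scheme_moment_Suc c_star_def)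
qed

text \<open>Orthogonality makes the \<open>d + 1\<close> idempotents independent, while the algebra
  is spanned by \<open>d + 1\<close> adjacency matrices.\<close>

lemma bose_mesner_subset_span_idempotents: "bose_mesner d R \<subseteq> span (E ` {..d})"
proof (rule card_ge_dim_independent)
  show "E ` {..d} \<subseteq> bose_mesner d R" using idempotent_in_algebra by auto
  have inj: "inj_on E {..d}" using ordering by (simp add: idempotent_ordering_def bij_betw_def)
  show "independent (E ` {..d})"
  proof (rule independent_if_scalars_zero)
    fix f M assume sum: "(\<Sum>M\<in>E ` {..d}. f M *\<^sub>R M) = 0" and "M \<in> E ` {..d}"
    then obtain j where j: "j \<le> d" "M = E j" by auto
    have "0 = (\<Sum>i\<le>d. f (E i) *\<^sub>R E i) $ x $ y" for x y
      using sum inj by (simp add: sum.reindex)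
    then have "0 = (\<Sum>x\<in>UNIV. \<Sum>y\<in>UNIV. (\<Sum>i\<le>d. f (E i) * E i $ x $ y) * E j $ x $ y)"
      by simp
    also have "\<dots> = (\<Sum>x\<in>UNIV. \<Sum>y\<in>UNIV. \<Sum>i\<le>d. f (E i) * (E i $ x $ y * E j $ x $ y))"
      by (simp add: sum_distrib_right mult.assoc)
    also have "\<dots> = (\<Sum>x\<in>UNIV. \<Sum>i\<le>d. \<Sum>y\<in>UNIV. f (E i) * (E i $ x $ y * E j $ x $ y))"
      by (intro sum.cong refl sum.swap)
    also have "\<dots> = (\<Sum>i\<le>d. \<Sum>x\<in>UNIV. \<Sum>y\<in>UNIV. f (E i) * (E i $ x $ y * E j $ x $ y))"
      by (rule sum.swap)
    also have "\<dots> = (\<Sum>i\<le>d. f (E i) * (if i = j then trace (E i) else 0))"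
      by (intro sum.cong refl) (simp add: sum_idempotent_mult j(1) flip: sum_distrib_left)
    also have "\<dots> = f (E j) * trace (E j)" using j by (simp add: if_distrib cong: if_cong)
    finally show "f M = 0" using trace_idempotent_pos[OF j(1)] j by simp
  qed simp
  have "dim (bose_mesner d R) \<le> card ((\<lambda>i. adjacency (R i)) ` {..d})"
    unfolding bose_mesner_def by (rule dim_le_card) auto
  also have "\<dots> \<le> card {..d}" by (rule card_image_le) simp
  also have "\<dots> = card (E ` {..d})" by (simp add: card_image inj)
  finally show "dim (bose_mesner d R) \<le> card (E ` {..d})" .
qed

text \<open>Every \<open>E j\<close> is obtained from \<open>E 1\<close> by the recurrence, so equal
  rows in \<open>E 1\<close> are equal rows in the whole algebra, in particular in the identity
  matrix.\<close>

lemma idempotent_rows_injective: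
  assumes rows: "\<And>z. E 1 $ x $ z = E 1 $ y $ z"
  shows "x = y"
proof -
  \<comment> \<open>The recurrence reaches back two indices, so the induction carries
    \<open>j\<close> and \<open>j - 1\<close> together; dividing by \<open>b_star j\<close> gives
    \<open>Suc j\<close>.\<close>
  have eq: "j \<le> d \<Longrightarrow> (\<forall>z. normalized_entry j x z = normalized_entry j y z) \<and>
      (\<forall>z. normalized_entry (j - 1) x z = normalized_entry (j - 1) y z)" for j
  proof (induction j)
    case 0
    then show ?case by (simp add: normalized_entry_0)
  next
    case (Suc j)
    then have j: "j < d" "j \<le> d" by simp_all
    have "b_star j * normalized_entry (Suc j) x z = b_star j * normalized_entry (Suc j) y z" for z
      using normalized_entry_recurrence[OF j(2), of x z] normalized_entry_recurrence[OF j(2), of y z]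
        Suc.IH[OF j(2)] rows by auto
    then show ?case using b_star_pos[OF j(1)] Suc.IH[OF j(2)] by simp
  qed
  have entries: "E j $ x $ z = E j $ y $ z" if "j \<le> d" for j z
  proof -
    have "normalized_entry j x z = normalized_entry j y z" using eq[OF that] by blast
    then show ?thesis using trace_idempotent_pos[OF that] by (simp add: normalized_entry_def)
  qed
  have "span (E ` {..d}) \<subseteq> {A. A $ x $ x = A $ y $ x}"
    by (rule span_minimal) (use entries in \<open>auto simp: subspace_def\<close>)
  moreover have "mat 1 \<in> bose_mesner d R"
  proof -
    have "adjacency (R 0) \<in> bose_mesner d R"
      unfolding bose_mesner_def by (rule span_base) simp
    then show ?thesis using scheme by (simp add: symmetric_association_scheme_def)
  qed
  ultimately have "(mat 1 :: real^'x^'x) $ x $ x = mat 1 $ y $ x"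
    using bose_mesner_subset_span_idempotents by blast
  then show ?thesis by (simp add: mat_def split: if_splits)
qed

end

section \<open>The embedding into the first eigenspace\<close>

lemma column_space_idempotent:
  fixes A :: "real^'x::finite^'x"
  assumes "A ** A = A" and "v \<in> column_space A"
  shows "A *v v = v"
proof -
  have "column_space A \<subseteq> {v. A *v v = v}"
    unfolding column_space_def
  proof (rule span_minimal)
    show "columns A \<subseteq> {v. A *v v = v}"
    proof
      fix v assume "v \<in> columns A"
      then obtain x where "v = A *v axis x 1" by (auto simp: columns_def matrix_vector_mult_basis)
      then show "v \<in> {v. A *v v = v}" using assms(1) by (simp add: matrix_vector_mul_assoc)
    qed
    show "subspace {v. A *v v = v}"
      by (auto simp: subspace_def matrix_vector_right_distrib matrix_vector_mult_scaleR)
  qed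
  then show ?thesis using assms(2) by blast
qed

lemma column_in_column_space: "A *v axis x 1 \<in> column_space (A :: real^'x::finite^'x)"
  unfolding column_space_def by (rule span_base) (auto simp: columns_def matrix_vector_mult_basis)

lemma projection_inner_columns:
  fixes A :: "real^'x::finite^'x"
  assumes "transpose A = A" and "A ** A = A"
  shows "(A *v axis x 1) \<bullet> (A *v axis y 1) = A $ x $ y"
proof -
  have "(A *v axis x 1) \<bullet> (A *v axis y 1) = axis x 1 \<bullet> (A *v (A *v axis y 1))"
    using assms(1) by (metis dot_lmul_matrix vector_transpose_matrix)
  also have "\<dots> = A $ x $ y"
    by (simp add: matrix_vector_mul_assoc assms(2)) (simp add: inner_axis' matrix_vector_mult_basis column_def)
  finally show ?thesis .
qed

text \<open>The standard basis pulls back to orthonormal vectors \<open>v i\<close> in the column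
  space, and \<open>v i $ x\<close> is the \<open>i\<close>-th coordinate of the image of column
  \<open>x\<close>. Summing the squares in both orders gives the trace and the dimension.\<close>

lemma trace_projection_eq_dimension:
  fixes A :: "real^'x::finite^'x" and \<phi> :: "real^'x \<Rightarrow> real^'m::finite"
  assumes sym: "transpose A = A" and idem: "A ** A = A"
    and iso: "isometric_identification (column_space A) \<phi>"
  shows "trace A = real CARD('m)"
proof -
  have "\<exists>w. w \<in> column_space A \<and> \<phi> w = u" for u
  proof -
    have "u \<in> \<phi> ` column_space A" using iso by (simp add: isometric_identification_def)
    then show ?thesis by blast
  qed
  then obtain g where g: "\<And>u. g u \<in> column_space A" "\<And>u. \<phi> (g u) = u" by metis
  define v where "v i = g (axis i 1)" for i
  have v: "v i \<in> column_space A" "\<phi> (v i) = axis i 1" for i by (simp_all add: v_def g)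
  have inner: "\<phi> u \<bullet> \<phi> w = u \<bullet> w" if "u \<in> column_space A" "w \<in> column_space A" for u w
    using iso that by (simp add: isometric_identification_def)
  have coord: "\<phi> (A *v axis x 1) $ i = v i $ x" for x i
  proof -
    have "\<phi> (A *v axis x 1) $ i = (A *v axis x 1) \<bullet> v i"
      using inner[OF column_in_column_space[of A x] v(1)[of i]] by (simp add: v(2) inner_axis)
    also have "\<dots> = axis x 1 \<bullet> (A *v v i)"
      using sym by (metis dot_lmul_matrix vector_transpose_matrix)
    also have "\<dots> = v i $ x"
      using column_space_idempotent[OF idem v(1)] by (simp add: inner_axis')
    finally show ?thesis .
  qed
  have "trace A = (\<Sum>x\<in>UNIV. \<phi> (A *v axis x 1) \<bullet> \<phi> (A *v axis x 1))"
    by (simp add: trace_def inner column_in_column_space projection_inner_columns[OF sym idem])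
  also have "\<dots> = (\<Sum>x\<in>UNIV. \<Sum>i\<in>UNIV. v i $ x * v i $ x)"
    by (simp add: inner_vec_def coord)
  also have "\<dots> = (\<Sum>i\<in>UNIV. \<Sum>x\<in>UNIV. v i $ x * v i $ x)" by (rule sum.swap)
  also have "\<dots> = (\<Sum>i\<in>UNIV. \<phi> (v i) \<bullet> \<phi> (v i))"
    unfolding inner[OF v(1) v(1)] by (simp add: inner_vec_def)
  also have "\<dots> = real CARD('m)" by (simp add: v(2) inner_axis_axis)
  finally show ?thesis .
qed

lemma inner_embedding:
  fixes A :: "real^'x::finite^'x" and \<phi> :: "real^'x \<Rightarrow> real^'m::finite"
  assumes "transpose A = A" and "A ** A = A"
    and iso: "isometric_identification (column_space A) \<phi>"
  shows "embedding A \<phi> x \<bullet> embedding A \<phi> y = real CARD('x) / real (rank A) * A $ x $ y"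
proof -
  define s where "s = sqrt (real CARD('x) / real (rank A))"
  have lin: "linear \<phi>" using iso by (simp add: isometric_identification_def)
  have "\<phi> (A *v axis x 1) \<bullet> \<phi> (A *v axis y 1) = A $ x $ y"
    using iso by (simp add: isometric_identification_def column_in_column_space projection_inner_columns[OF assms(1,2)])
  then have "embedding A \<phi> x \<bullet> embedding A \<phi> y = s * s * A $ x $ y"
    by (simp add: embedding_def linear_cmul[OF lin] flip: s_def)
  moreover have "s * s = real CARD('x) / real (rank A)" by (simp add: s_def)
  ultimately show ?thesis by metis
qed

theorem theorem3p1:
  fixes R :: "nat \<Rightarrow> ('x::finite \<times> 'x) set"
    and E :: "nat \<Rightarrow> real^'x^'x"
    and q :: "nat \<Rightarrow> nat \<Rightarrow> nat \<Rightarrow> real"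
    and \<theta> :: "nat \<Rightarrow> real"
    and \<phi> :: "real^'x \<Rightarrow> real^'m::finite"
    and d m t :: nat
  assumes "symmetric_association_scheme d R"
    and "idempotent_ordering d R E"
    and "krein_parameters d E q"
    and "Q_polynomial d q"
    and "E 1 = (1 / real CARD('x)) *\<^sub>R (\<Sum>j\<le>d. \<theta> j *\<^sub>R adjacency (R j))"
    and "m = rank (E 1)"
    and "CARD('m) = m"
    and "isometric_identification (column_space (E 1)) \<phi>"
    and "1 \<le> t"
    and "t \<le> 2 * d"
  shows "\<theta> 0 = real m \<and>
    (spherical_design t (range (embedding (E 1) \<phi>)) \<longleftrightarrow>
      (\<forall>i. int i \<le> \<lfloor>(real t - 1) / 2\<rfloor> \<longrightarrow> a_star q i = 0) \<and>
      (\<forall>j. int j \<le> \<lceil>(real t - 1) / 2\<rceil> \<longrightarrow>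
        c_star q j = real m * real j / (real m + 2 * real j - 2)))"
proof -
  interpret ordered_scheme d R E q
    using assms by unfold_locales auto
  have sym: "transpose (E 1) = E 1"
    by (rule bose_mesner_symmetric[OF scheme idempotent_in_algebra[OF d_pos]])
  have idem: "E 1 ** E 1 = E 1" using d_pos by (simp add: idempotent_mult)
  have tr: "trace (E 1) = real m"
    using trace_projection_eq_dimension[OF sym idem assms(8)] assms(7) by simp
  have m: "1 \<le> m" using assms(7) by (metis One_nat_def Suc_leI zero_less_card_finite)
  have "\<theta> 0 = real m"
  \<comment> \<open>Compares diagonal entries: only \<open>R 0\<close> meets the diagonal, and
    \<open>E 1\<close> has \<open>m / |X|\<close> there.\<close>
  proof -
    fix x :: 'x
    have "E 1 $ x $ x = (\<Sum>j\<le>d. \<theta> j * adjacency (R j) $ x $ x) / real CARD('x)"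
      by (subst assms(5)) simp
    also have "(\<Sum>j\<le>d. \<theta> j * adjacency (R j) $ x $ x) = (\<Sum>j\<le>d. if j = 0 then \<theta> j else 0)"
      by (intro sum.cong refl) (simp add: adjacency_diagonal[OF scheme])
    finally show ?thesis using idempotent_diagonal[OF d_pos, of x] tr by simp
  qed
  moreover have "spherical_design t (range (embedding (E 1) \<phi>)) \<longleftrightarrow>
      (\<forall>k\<le>t. scheme_moment k 0 = real m ^ k * gegenbauer_moment m k 0)"
  proof -
    let ?e = "embedding (E 1) \<phi>"
    have inner: "?e x \<bullet> ?e y = real CARD('x) * E 1 $ x $ y / real m" for x y
      using inner_embedding[OF sym idem assms(8)] assms(6) by simp
    \<comment> \<open>A design averages over a set, so distinct points need distinct images for sums
      over \<open>range ?e\<close> to become sums over all points of the scheme.\<close>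
    have inj: "inj ?e"
    proof (rule injI)
      fix x y assume eq: "?e x = ?e y"
      have "E 1 $ x $ z = E 1 $ y $ z" for z
        using inner[of x z] inner[of y z] m unfolding eq by simp
      then show "x = y" by (rule idempotent_rows_injective)
    qed
    have "range ?e \<subseteq> sphere 0 1"
      using inner idempotent_diagonal[OF d_pos] tr m by (auto simp: norm_eq_1)
    moreover have "(\<Sum>x\<in>range ?e. \<Sum>y\<in>range ?e. (x \<bullet> y) ^ k) / (real (card (range ?e)))\<^sup>2 =
        scheme_moment k 0 / real m ^ k" for k
      using inj by (simp add: sum.reindex card_image inner scheme_moment_def normalized_entry_0
          power_divide del: One_nat_def flip: sum_divide_distrib)
    ultimately show ?thesis
      using m by (simp add: spherical_design_iff_inner_power_sums assms(7) divide_eq_eq mult.commute)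
  qed
  moreover have "\<dots> \<longleftrightarrow>
      (\<forall>i. 2 * i + 1 \<le> t \<longrightarrow> a_star q i = 0) \<and>
      (\<forall>j. 2 * j \<le> t \<longrightarrow> c_star q j = real m * real j / (real m + 2 * real j - 2))"
  proof (rule tridiagonal_array_moments_eq_iff[OF tridiagonal_array_scheme_moment
        tridiagonal_array_gegenbauer_moment[OF m] _ _ _ _ assms(10)])
    show "b_star i = real m - a_star q i - c_star q i" if "i \<le> d" for i
      using b_star_eq[OF that] tr by simp
    show "b_star i \<noteq> 0" if "i < d" for i using b_star_pos[OF that] by simp
    show "c_star q i \<noteq> 0" if "1 \<le> i" "i \<le> d" for i using c_star_pos[OF that] by simp
  qed simp
  \<comment> \<open>Integrality removes the rounding; the ceiling of \<open>(t - 1) / 2\<close> is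
    the floor of \<open>t / 2\<close>.\<close>
  moreover have "int i \<le> \<lfloor>(real t - 1) / 2\<rfloor> \<longleftrightarrow> 2 * i + 1 \<le> t" for i
    by (simp add: le_floor_iff field_simps) linarith
  moreover have "int j \<le> \<lceil>(real t - 1) / 2\<rceil> \<longleftrightarrow> 2 * j \<le> t" for j
    by (simp add: le_ceiling_iff field_simps) linarith
  ultimately show ?thesis by simp
qed

end
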